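(* Let $\mu>0$ and $\varepsilon>0$ with $\varepsilon<\mu^2/4$. Then for all $g\in\mathcal{D}_\mu(\mathbb{R}_+)$, \[ \int_0^\infty (g'')^2x^{\mu+1}dx\int_0^\infty\left(x^2(g')^2-\varepsilon g^2\right)x^{\mu-1}dx\ge\frac{1}{4}\left(\sqrt{\mu^2-4\varepsilon}+1\right)^2\left(\int_0^\infty (g')^2x^{\mu}dx\right)^2, \] and the constant $\frac14(\sqrt{\mu^2-4\varepsilon}+1)^2$ is the best possible. Moreover, the set of all functions in $\mathcal{D}_\mu(\mathbb{R}_+)$ achieving equality is \[ \left\{C e^{-\lambda x}\,{}_1F_1(b,\mu,\lambda x)\ :\ C\in\mathbb{R},\ \lambda>0\right\},\qquad b=\frac{\mu-\sqrt{\mu^2-4\varepsilon}}{2}, \] where ${}_1F_1(b,\mu,x)=\sum_{k=0}^\infty\frac{(b)_k}{(\mu)_k}\frac{x^k}{k!}$ is Kummer's confluent hypergeometric function, with $(q)_0=1$ and $(q)_k=q(q+1)\cdots(q+k-1)$ for $k\ge1$.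
   Context: $\mathbb{R}_+=(0,\infty)$, $g'=dg/dx$, $g''=d^2g/dx^2$. For $\mu>0$, $C^\infty_\mu(\mathbb{R}_+)$ is the set of real smooth functions $g$ on $(0,\infty)$ with $\limsup_{x\to0}(|g(x)|+|g'(x)|)<\infty$ and $\lim_{x\to\infty}\left(x^{\mu+1}(g'(x))^2+x^\mu(g(x))^2\right)=0$. The space $\mathcal{D}_\mu(\mathbb{R}_+)$ is the Hilbert space completion of $\{g\in C^\infty_\mu(\mathbb{R}_+):\|g\|_{\mathcal{D}_\mu}<\infty\}$ with respect to the norm \[ \|g\|_{\mathcal{D}_\mu}=\left(4\int_0^\infty (g'')^2x^{\mu+1}dx+\int_0^\infty (g')^2(x+1)x^\mu dx+\int_0^\infty g^2x^{\mu-1}dx\right)^{1/2}, \] on which all integrals in the inequality are well defined (by continuous extension). "Best possible" means the constant equals the infimum over nonzero $g\in\mathcal{D}_\mu(\mathbb{R}_+)$ of the left-hand side divided by $\left(\int_0^\infty(g')^2x^\mu dx\right)^2$. *)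

theory Defs
  imports "HOL-Analysis.Analysis"
begin

definition smooth_pos :: "(real \<Rightarrow> real) \<Rightarrow> bool" where
  "smooth_pos g \<longleftrightarrow> (\<forall>k::nat. \<forall>x>0. ((deriv ^^ k) g) differentiable (at x))"

definition Cinf_mu :: "real \<Rightarrow> (real \<Rightarrow> real) set" where
  "Cinf_mu \<mu> = {g. smooth_pos g
      \<and> Limsup (at_right 0) (\<lambda>x. ereal (\<bar>g x\<bar> + \<bar>deriv g x\<bar>)) < \<infinity>
      \<and> ((\<lambda>x. x powr (\<mu>+1) * (deriv g x)\<^sup>2 + x powr \<mu> * (g x)\<^sup>2) \<longlongrightarrow> 0) at_top}"

text \<open>Squared D-mu norm (meaningful when the three integrals are finite).\<close>
definition Dnorm2 :: "real \<Rightarrow> (real \<Rightarrow> real) \<Rightarrow> real" where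
  "Dnorm2 \<mu> g =
     4 * (LINT x:{0<..}|lborel. (deriv (deriv g) x)\<^sup>2 * x powr (\<mu>+1))
     + (LINT x:{0<..}|lborel. (deriv g x)\<^sup>2 * (x+1) * x powr \<mu>)
     + (LINT x:{0<..}|lborel. (g x)\<^sup>2 * x powr (\<mu>-1))"

definition Dnorm :: "real \<Rightarrow> (real \<Rightarrow> real) \<Rightarrow> real" where
  "Dnorm \<mu> g = sqrt (Dnorm2 \<mu> g)"

definition Dpre :: "real \<Rightarrow> (real \<Rightarrow> real) set" where
  "Dpre \<mu> = {g \<in> Cinf_mu \<mu>.
      set_integrable lborel {0<..} (\<lambda>x. (deriv (deriv g) x)\<^sup>2 * x powr (\<mu>+1))
    \<and> set_integrable lborel {0<..} (\<lambda>x. (deriv g x)\<^sup>2 * (x+1) * x powr \<mu>)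
    \<and> set_integrable lborel {0<..} (\<lambda>x. (g x)\<^sup>2 * x powr (\<mu>-1))}"

text \<open>The completion D-mu is represented by Cauchy sequences in Dpre (two such
  sequences represent the same element iff their difference tends to 0 in norm).\<close>
definition Dmu :: "real \<Rightarrow> (nat \<Rightarrow> real \<Rightarrow> real) set" where
  "Dmu \<mu> = {s. (\<forall>n. s n \<in> Dpre \<mu>) \<and>
      (\<forall>e>0. \<exists>N. \<forall>m\<ge>N. \<forall>n\<ge>N. Dnorm \<mu> (s m - s n) < e)}"

text \<open>Continuous extensions of the integral functionals to the completion.\<close>
definition I_gpp :: "real \<Rightarrow> (nat \<Rightarrow> real \<Rightarrow> real) \<Rightarrow> real" where
  "I_gpp \<mu> s = lim (\<lambda>n. LINT x:{0<..}|lborel. (deriv (deriv (s n)) x)\<^sup>2 * x powr (\<mu>+1))"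

definition I_eps :: "real \<Rightarrow> real \<Rightarrow> (nat \<Rightarrow> real \<Rightarrow> real) \<Rightarrow> real" where
  "I_eps \<mu> \<epsilon> s = lim (\<lambda>n. LINT x:{0<..}|lborel.
       (x\<^sup>2 * (deriv (s n) x)\<^sup>2 - \<epsilon> * (s n x)\<^sup>2) * x powr (\<mu>-1))"

definition I_gp :: "real \<Rightarrow> (nat \<Rightarrow> real \<Rightarrow> real) \<Rightarrow> real" where
  "I_gp \<mu> s = lim (\<lambda>n. LINT x:{0<..}|lborel. (deriv (s n) x)\<^sup>2 * x powr \<mu>)"

definition hyp1F1 :: "real \<Rightarrow> real \<Rightarrow> real \<Rightarrow> real" where
  "hyp1F1 b c x = (\<Sum>k. pochhammer b k / pochhammer c k * x ^ k / fact k)"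

end

theory Submission
  imports Defs
begin

text \<open>
  Put \<open>s = sqrt (\<mu>^2 - 4 \<epsilon>)\<close>, \<open>a = (\<mu> + s) / 2\<close> and \<open>L g = x g'' + (\<mu> + \<lambda> x) g' + a \<lambda> g\<close>.
  Integration by parts gives, for every \<open>\<lambda> > 0\<close>,
  \<open>\<integral> (L g)^2 x^(\<mu>-1) = A + \<lambda>^2 B - \<lambda> (s + 1) D\<close> where \<open>A\<close>, \<open>B\<close>, \<open>D\<close> are the three integrals
  of the inequality. Nonnegativity for all \<open>\<lambda>\<close> is the inequality \<open>A B \<ge> ((s + 1) / 2)^2 D^2\<close>.
  If equality holds with \<open>D > 0\<close>, then \<open>\<lambda> = sqrt (A / B)\<close> makes \<open>L g\<close> vanish in the limit along
  the Cauchy sequence; the Wronskian with the solution \<open>u = exp (-\<lambda> x) 1F1(b, \<mu>, \<lambda> x)\<close> of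
  \<open>L u = 0\<close> then tends to 0, which forces convergence to a multiple of \<open>u\<close>. The second solution of
  \<open>L u = 0\<close> is excluded because elements of \<open>Cinf_mu\<close> and their derivatives are bounded near 0.
  Convergence in norm follows from pointwise convergence of the first derivatives, because the
  form is closable; this also settles the case \<open>D = 0\<close>.
\<close>

section \<open>Integrals over the positive half-line\<close>

text \<open>The numbers \<open>a\<close> and \<open>b\<close> are the larger and the smaller root of
  \<open>a * (a - \<mu>) = - \<epsilon>\<close>, so \<open>a + b = \<mu>\<close>. Either root gives
  the integral of g^2 in the expanded square the coefficient -\<epsilon> \<lambda>^2; the cross term
  carries 2 a - \<mu> + 1, which is s + 1 for the larger root but only 1 - s for the smaller. The
  condition \<epsilon> > 0 gives b > 0, so the Kummer series has positive coefficients, and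
  \<epsilon> < \<mu>^2/4 gives b < a, the decay that puts the extremals into the space. The obstacle
  is that elements of the completion are Cauchy sequences, with no limit function at hand. Limits
  are therefore taken along sequences, and closability takes the form: if the first derivatives of a
  Cauchy sequence tend to 0 pointwise, then so does its norm. Product estimates are derived from a
  quadratic in a parameter t > 0 that stays nonnegative, which avoids dividing by integrals that may
  vanish.\<close>

abbreviation pos_int :: "(real \<Rightarrow> real) \<Rightarrow> real" where
  "pos_int f \<equiv> (LINT x:{0<..}|lborel. f x)"

abbreviation pos_integrable :: "(real \<Rightarrow> real) \<Rightarrow> bool" where
  "pos_integrable f \<equiv> set_integrable lborel {0<..} f"

lemma set_borel_measurable_continuous_pos:
  fixes f :: "real \<Rightarrow> real"
  assumes "continuous_on {0<..} f"
  shows "set_borel_measurable lborel {0<..} f"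
  unfolding set_borel_measurable_def
  using borel_measurable_continuous_on_indicator[OF _ assms] by simp

lemma pos_integrable_bound:
  assumes "pos_integrable f" "continuous_on {0<..} g" "\<And>x. x > 0 \<Longrightarrow> \<bar>g x\<bar> \<le> f x"
  shows "pos_integrable g"
proof (rule set_integrable_bound[OF assms(1) set_borel_measurable_continuous_pos[OF assms(2)]])
  show "AE x in lborel. x \<in> {0<..} \<longrightarrow> norm (g x) \<le> norm (f x)"
    using assms(3) by (auto intro!: AE_I2 order_trans[OF _ abs_ge_self])
qed

lemma pos_int_cong:
  assumes "\<And>x. x > 0 \<Longrightarrow> f x = g x"
  shows "pos_int f = pos_int g"
  by (rule set_lebesgue_integral_cong) (use assms in auto)

lemma pos_integrable_cong:
  assumes "\<And>x. x > 0 \<Longrightarrow> f x = g x"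
  shows "pos_integrable f \<longleftrightarrow> pos_integrable g"
  by (rule set_integrable_cong) (use assms in auto)

lemma pos_int_nonneg:
  assumes "\<And>x. x > 0 \<Longrightarrow> 0 \<le> f x"
  shows "0 \<le> pos_int f"
  unfolding set_lebesgue_integral_def
  by (rule integral_nonneg_AE) (use assms in \<open>auto simp: indicator_def\<close>)

lemma set_integral_FTC:
  fixes F f :: "real \<Rightarrow> real"
  assumes "u \<le> v" "\<And>x. u \<le> x \<Longrightarrow> x \<le> v \<Longrightarrow> (F has_real_derivative f x) (at x)"
    "continuous_on {u..v} f"
  shows "set_integrable lborel {u..v} f" "(LINT x:{u..v}|lborel. f x) = F v - F u"
proof -
  have d: "\<And>x. u \<le> x \<Longrightarrow> x \<le> v \<Longrightarrow> (F has_vector_derivative f x) (at x within {u..v})"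
    unfolding has_real_derivative_iff_has_vector_derivative[symmetric]
    using assms(2) by (auto intro: DERIV_subset)
  show "set_integrable lborel {u..v} f" "(LINT x:{u..v}|lborel. f x) = F v - F u"
    using has_bochner_integral_FTC_Icc[OF assms(1) d assms(3)]
    unfolding set_integrable_def set_lebesgue_integral_def
    by (auto simp: has_bochner_integral_iff)
qed

lemma set_int_le_pos_int:
  assumes "pos_integrable h" "\<And>x. x > 0 \<Longrightarrow> 0 \<le> h x" "0 < u"
  shows "set_integrable lborel {u..v} h" "(LINT x:{u..v}|lborel. h x) \<le> pos_int h"
proof -
  show hI: "set_integrable lborel {u..v} h"
    by (rule set_integrable_subset[OF assms(1)]) (use assms(3) in auto)
  show "(LINT x:{u..v}|lborel. h x) \<le> pos_int h"
    unfolding set_lebesgue_integral_def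
    by (rule integral_mono) (use assms hI in \<open>auto simp: set_integrable_def indicator_def\<close>)
qed

text \<open>The Henstock-Kurzweil integral is the bridge: there every derivative is integrable, so
  Lebesgue integrability is asked of the majorant \<open>h\<close> alone.\<close>

lemma FTC_le_pos_int:
  fixes F f :: "real \<Rightarrow> real"
  assumes "0 < u" "u \<le> v" "\<And>x. u \<le> x \<Longrightarrow> x \<le> v \<Longrightarrow> (F has_real_derivative f x) (at x)"
    "\<And>x. u \<le> x \<Longrightarrow> x \<le> v \<Longrightarrow> f x \<le> h x"
    "pos_integrable h" "\<And>x. x > 0 \<Longrightarrow> 0 \<le> h x"
  shows "F v - F u \<le> pos_int h"
proof -
  have F: "(f has_integral (F v - F u)) {u..v}"
    by (rule fundamental_theorem_of_calculus)
      (use assms in \<open>auto simp: has_real_derivative_iff_has_vector_derivative[symmetric]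
        intro: DERIV_subset\<close>)
  note hI = set_int_le_pos_int[OF assms(5,6,1), of v]
  have "F v - F u \<le> integral {u..v} h"
    by (rule has_integral_le[OF F integrable_integral])
      (use set_borel_integral_eq_integral(1)[OF hI(1)] assms(4) in auto)
  also have "\<dots> = (LINT x:{u..v}|lborel. h x)"
    using set_borel_integral_eq_integral(2)[OF hI(1)] by simp
  also have "\<dots> \<le> pos_int h" by (rule hI(2))
  finally show ?thesis .
qed

lemma exhausting_intervals: "(\<Union>k. {1 / real (Suc k)..real (Suc k)}) = {0<..}"
proof -
  have "\<exists>k. 1 / real (Suc k) \<le> x \<and> x \<le> real (Suc k)" if "x > 0" for x :: real
  proof -
    obtain k where k: "max x (1/x) \<le> real k" using real_arch_simple by blast
    hence "1 / x \<le> real (Suc k)" "x \<le> real (Suc k)" by auto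
    hence "1 / real (Suc k) \<le> x" using that by (simp add: field_simps)
    thus ?thesis using \<open>x \<le> real (Suc k)\<close> by blast
  qed
  thus ?thesis by (auto intro: less_le_trans[of 0 "1 / real (Suc _)"])
qed

lemma incseq_exhausting_intervals: "incseq (\<lambda>k. {1 / real (Suc k)..real (Suc k)})"
  by (auto simp: incseq_def frac_le intro: order_trans[rotated])

lemma pos_int_exhaust:
  assumes "pos_integrable f"
  shows "(\<lambda>k. LINT x:{1 / real (Suc k)..real (Suc k)}|lborel. f x) \<longlonglongrightarrow> pos_int f"
  using set_integral_cont_up[of "\<lambda>k. {1 / real (Suc k)..real (Suc k)}" lborel f]
    assms incseq_exhausting_intervals
  by (simp only: exhausting_intervals) simp

lemma pos_integrable_exhaust:
  assumes c: "continuous_on {0<..} f" and nn: "\<And>x. x > 0 \<Longrightarrow> 0 \<le> f x"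
    and lim: "(\<lambda>k. LINT x:{1 / real (Suc k)..real (Suc k)}|lborel. f x) \<longlonglongrightarrow> L"
  shows "pos_integrable f" "pos_int f = L"
proof -
  let ?I = "\<lambda>k. {1 / real (Suc k)..real (Suc k)}"
  let ?f = "\<lambda>k x. indicator (?I k) x *\<^sub>R f x"
  have pos: "x > 0" if "x \<in> ?I k" for x k
    using that by (auto intro: less_le_trans[of 0 "1 / real (Suc _)"])
  have i: "integrable lborel (?f k)" for k
    by (rule borel_integrable_compact) (use pos in \<open>auto intro: continuous_on_subset[OF c]\<close>)
  have m: "AE x in lborel. mono (\<lambda>k. ?f k x)"
  proof (rule AE_I2, rule monoI)
    fix x and k l :: nat assume "k \<le> l"
    hence "?I k \<subseteq> ?I l" using incseq_exhausting_intervals by (auto simp: incseq_def)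
    thus "?f k x \<le> ?f l x" using nn pos by (auto simp: indicator_def)
  qed
  have p: "AE x in lborel. (\<lambda>k. ?f k x) \<longlonglongrightarrow> indicator {0<..} x *\<^sub>R f x"
  proof (rule AE_I2)
    fix x :: real
    show "(\<lambda>k. ?f k x) \<longlonglongrightarrow> indicator {0<..} x *\<^sub>R f x"
      using LIMSEQ_indicator_incseq[OF incseq_exhausting_intervals, of x]
      by (intro tendsto_scaleR tendsto_const) (simp only: exhausting_intervals)
  qed
  have l: "(\<lambda>k. integral\<^sup>L lborel (?f k)) \<longlonglongrightarrow> L"
    using lim by (simp only: set_lebesgue_integral_def)
  have b: "(\<lambda>x. indicator {0<..} x *\<^sub>R f x) \<in> borel_measurable lborel"
    using set_borel_measurable_continuous_pos[OF c] by (simp add: set_borel_measurable_def)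
  show "pos_integrable f" "pos_int f = L"
    using integrable_monotone_convergence[OF i m p l b] integral_monotone_convergence[OF i m p l b]
    by (auto simp: set_integrable_def set_lebesgue_integral_def)
qed

lemma pos_int_Fatou:
  assumes i: "\<And>m. pos_integrable (f m)" "pos_integrable g"
    and nn: "\<And>m x. x > 0 \<Longrightarrow> 0 \<le> f m x" "\<And>x. x > 0 \<Longrightarrow> 0 \<le> g x"
    and lim: "\<And>x. x > 0 \<Longrightarrow> (\<lambda>m. f m x) \<longlonglongrightarrow> g x"
    and le: "\<And>m. m \<ge> N \<Longrightarrow> pos_int (f m) \<le> e"
  shows "pos_int g \<le> e"
proof -
  let ?f = "\<lambda>m x. indicator {0<..} x * f m x" and ?g = "\<lambda>x. indicator {0<..} x * g x"
  have e: "0 \<le> e" using le[of N] pos_int_nonneg[of "f N"] nn(1) by force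
  have [measurable]: "\<And>m. ?f m \<in> borel_measurable borel" "?g \<in> borel_measurable borel"
    using i borel_measurable_integrable[of lborel] by (auto simp: set_integrable_def)
  have "ennreal (pos_int g) = (\<integral>\<^sup>+x. ennreal (?g x) \<partial>lborel)"
    using nn_integral_eq_integral[of lborel ?g] i(2) nn(2)
    by (auto simp: set_integrable_def set_lebesgue_integral_def indicator_def)
  also have "\<dots> = (\<integral>\<^sup>+x. liminf (\<lambda>m. ennreal (?f m x)) \<partial>lborel)"
  proof (rule nn_integral_cong)
    fix x :: real
    have "(\<lambda>m. ennreal (?f m x)) \<longlonglongrightarrow> ennreal (?g x)"
      by (rule tendsto_ennrealI) (use lim in \<open>auto simp: indicator_def\<close>)
    thus "ennreal (?g x) = liminf (\<lambda>m. ennreal (?f m x))"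
      by (simp add: lim_imp_Liminf)
  qed
  also have "\<dots> \<le> liminf (\<lambda>m. \<integral>\<^sup>+x. ennreal (?f m x) \<partial>lborel)"
    by (rule nn_integral_liminf) simp
  also have "\<dots> \<le> ennreal e"
  proof (rule Liminf_le[OF sequentially_bot])
    have "(\<integral>\<^sup>+x. ennreal (?f m x) \<partial>lborel) = ennreal (pos_int (f m))" for m
      using nn_integral_eq_integral[of lborel "?f m"] i(1)[of m] nn(1)
      by (auto simp: set_integrable_def set_lebesgue_integral_def indicator_def)
    thus "\<forall>\<^sub>F m in sequentially. (\<integral>\<^sup>+x. ennreal (?f m x) \<partial>lborel) \<le> ennreal e"
      using le e by (auto simp: eventually_sequentially intro!: exI[of _ N] ennreal_leI)
  qed
  finally show ?thesis using e by (simp add: ennreal_le_iff)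
qed

text \<open>Integration by parts on the whole half-line with vanishing boundary terms. Integrability
  of \<open>f\<close> is a conclusion: its integrals over the exhausting intervals differ from those
  of \<open>h\<close> by increments of \<open>F\<close>, and monotone convergence applies.\<close>

lemma pos_int_eq_FTC:
  fixes F F' f h :: "real \<Rightarrow> real"
  assumes c: "continuous_on {0<..} f" "continuous_on {0<..} h" and nn: "\<And>x. x > 0 \<Longrightarrow> 0 \<le> f x"
    and hi: "pos_integrable h"
    and d: "\<And>x. x > 0 \<Longrightarrow> (F has_real_derivative (f x - h x)) (at x)"
    and l0: "(F \<longlongrightarrow> 0) (at_right 0)" and l1: "(F \<longlongrightarrow> 0) at_top"
  shows "pos_integrable f" "pos_int f = pos_int h"
proof -
  let ?I = "\<lambda>k. {1 / real (Suc k)..real (Suc k)}"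
  have pos: "x > 0" if "x \<in> ?I k" for x k
    using that by (auto intro: less_le_trans[of 0 "1 / real (Suc _)"])
  have le: "1 / real (Suc k) \<le> real (Suc k)" for k
    by (simp add: field_simps)
  have sub: "?I k \<subseteq> {0<..}" for k using pos by auto
  have e: "(LINT x:?I k|lborel. f x) =
      (LINT x:?I k|lborel. h x) + (F (real (Suc k)) - F (1 / real (Suc k)))" for k
  proof -
    have cont: "continuous_on (?I k) (\<lambda>x. f x - h x)"
      by (intro continuous_intros continuous_on_subset[OF c(1) sub] continuous_on_subset[OF c(2) sub])
    have 1: "set_integrable lborel (?I k) (\<lambda>x. f x - h x)"
      "(LINT x:?I k|lborel. f x - h x) = F (real (Suc k)) - F (1 / real (Suc k))"
      using set_integral_FTC[OF le _ cont, of F] d pos[of _ k] by auto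
    have "set_integrable lborel (?I k) h"
      by (rule set_integrable_subset[OF hi _ sub]) simp
    from set_integral_add(2)[OF this 1(1)] 1(2) show ?thesis by simp
  qed
  have t: "(\<lambda>k. LINT x:?I k|lborel. f x) \<longlonglongrightarrow> pos_int h + (0 - 0)"
    unfolding e
  proof (intro tendsto_intros pos_int_exhaust hi)
    show "(\<lambda>k. F (real (Suc k))) \<longlonglongrightarrow> 0"
      by (rule filterlim_compose[OF l1])
        (intro filterlim_compose[OF filterlim_real_sequentially] filterlim_Suc)
    have "filterlim (\<lambda>k. 1 / real (Suc k)) (at_right 0) sequentially"
      by (auto simp: filterlim_at simp del: of_nat_Suc intro!: LIMSEQ_Suc[OF lim_1_over_n])
    thus "(\<lambda>k. F (1 / real (Suc k))) \<longlonglongrightarrow> 0" by (rule filterlim_compose[OF l0])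
  qed
  thus "pos_integrable f" "pos_int f = pos_int h"
    using pos_integrable_exhaust[OF c(1) nn t] by auto
qed

section \<open>Weighted square integrals\<close>

definition wint :: "real \<Rightarrow> (real \<Rightarrow> real) \<Rightarrow> real" where
  "wint p \<phi> = pos_int (\<lambda>x. (\<phi> x)\<^sup>2 * x powr p)"

text \<open>Continuity is built in so that measurability of products and differences on the
  half-line is immediate.\<close>

definition wl2 :: "real \<Rightarrow> (real \<Rightarrow> real) \<Rightarrow> bool" where
  "wl2 p \<phi> \<longleftrightarrow> continuous_on {0<..} \<phi> \<and> pos_integrable (\<lambda>x. (\<phi> x)\<^sup>2 * x powr p)"

lemma wint_nonneg: "0 \<le> wint p \<phi>"
  unfolding wint_def by (rule pos_int_nonneg) auto

lemma wint_cong: "(\<And>x. x > 0 \<Longrightarrow> \<phi> x = \<psi> x) \<Longrightarrow> wint p \<phi> = wint p \<psi>"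
  unfolding wint_def by (rule pos_int_cong) simp

lemma wl2_cong: "(\<And>x. x > 0 \<Longrightarrow> \<phi> x = \<psi> x) \<Longrightarrow> wl2 p \<phi> = wl2 p \<psi>"
  unfolding wl2_def using pos_integrable_cong[of "\<lambda>x. (\<phi> x)\<^sup>2 * x powr p" "\<lambda>x. (\<psi> x)\<^sup>2 * x powr p"]
    continuous_on_cong[of "{0<..}" "{0<..}" \<phi> \<psi>] by simp

lemma wl2_mult:
  assumes "wl2 p \<phi>" "wl2 q \<psi>" "r = (p + q) / 2"
  shows "pos_integrable (\<lambda>x. \<phi> x * \<psi> x * x powr r)"
proof (rule pos_integrable_bound)
  show "pos_integrable (\<lambda>x. (\<phi> x)\<^sup>2 * x powr p + (\<psi> x)\<^sup>2 * x powr q)"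
    using assms by (auto simp: wl2_def)
  show "continuous_on {0<..} (\<lambda>x. \<phi> x * \<psi> x * x powr r)"
    using assms by (auto simp: wl2_def intro!: continuous_intros)
  fix x :: real assume "x > 0"
  have r: "x powr r = x powr (p/2) * x powr (q/2)" "x powr p = (x powr (p/2))\<^sup>2" "x powr q = (x powr (q/2))\<^sup>2"
    using assms(3) by (simp_all add: powr_add[symmetric] power2_eq_square add_divide_distrib)
  define A where "A = \<phi> x * x powr (p/2)"
  define B where "B = \<psi> x * x powr (q/2)"
  have "\<bar>A * B\<bar> \<le> A\<^sup>2 + B\<^sup>2"
    using sum_squares_bound[of "\<bar>A\<bar>" "\<bar>B\<bar>"] abs_ge_zero[of "A*B"]
    unfolding abs_mult power2_abs by linarith
  thus "\<bar>\<phi> x * \<psi> x * x powr r\<bar> \<le> (\<phi> x)\<^sup>2 * x powr p + (\<psi> x)\<^sup>2 * x powr q"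
    unfolding r A_def B_def by (simp add: power_mult_distrib mult_ac)
qed

lemma wl2_scale: "wl2 p \<phi> \<Longrightarrow> wl2 p (\<lambda>x. c * \<phi> x)"
  by (auto simp: wl2_def power_mult_distrib mult.assoc intro!: continuous_intros)

lemma wint_scale: "wint p (\<lambda>x. c * \<phi> x) = c\<^sup>2 * wint p \<phi>"
  by (simp add: wint_def power_mult_distrib mult.assoc)

lemma wl2_diff:
  assumes "wl2 p \<phi>" "wl2 p \<psi>"
  shows "wl2 p (\<lambda>x. \<phi> x - \<psi> x)"
    and "wint p (\<lambda>x. \<phi> x - \<psi> x) =
      wint p \<phi> - 2 * pos_int (\<lambda>x. \<phi> x * \<psi> x * x powr p) + wint p \<psi>"
proof -
  have e: "(\<lambda>x. (\<phi> x - \<psi> x)\<^sup>2 * x powr p) =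
      (\<lambda>x. (\<phi> x)\<^sup>2 * x powr p - 2 * (\<phi> x * \<psi> x * x powr p) + (\<psi> x)\<^sup>2 * x powr p)"
    by (rule ext) (simp add: power2_eq_square algebra_simps)
  have i: "pos_integrable (\<lambda>x. 2 * (\<phi> x * \<psi> x * x powr p))"
    using wl2_mult[OF assms, of p] by simp
  show "wl2 p (\<lambda>x. \<phi> x - \<psi> x)" using assms i
    unfolding wl2_def e by (auto intro!: continuous_intros)
  show "wint p (\<lambda>x. \<phi> x - \<psi> x) =
      wint p \<phi> - 2 * pos_int (\<lambda>x. \<phi> x * \<psi> x * x powr p) + wint p \<psi>"
    using assms i unfolding wint_def e wl2_def
    by (simp add: set_integral_add set_integral_diff)
qed

text \<open>A discriminant criterion that tests positive t only; this suffices because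
  \<open>Y \<ge> 0\<close> puts the vertex \<open>Y / Z\<close> on the positive side. The product
  estimates below all come from verifying its hypothesis.\<close>

lemma quadratic_nonneg_imp:
  fixes X Y Z :: real
  assumes h: "\<And>t. t > 0 \<Longrightarrow> 0 \<le> X - 2 * t * Y + t\<^sup>2 * Z" and "X \<ge> 0" "Y \<ge> 0"
  shows "Z \<ge> 0" "Y\<^sup>2 \<le> X * Z"
proof -
  show Z: "Z \<ge> 0"
  proof (rule ccontr)
    assume "\<not> Z \<ge> 0"
    hence z: "Z < 0" by simp
    \<comment> \<open>Chosen so that \<open>t * Z = Z - X\<close>; as t is at least 1, the quadratic
      term then outweighs \<open>X\<close>.\<close>
    define t where "t = 1 + X / (-Z)"
    have t: "t \<ge> 1" using z \<open>X \<ge> 0\<close> by (simp add: t_def divide_nonneg_neg)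
    have "t * 1 \<le> t * t" using t by (intro mult_left_mono) auto
    hence "t\<^sup>2 * Z \<le> t * Z" using z mult_right_mono_neg[of t "t * t" Z]
      by (simp add: power2_eq_square)
    also have "t * Z = Z - X" using z by (simp add: t_def field_simps)
    finally have "X - 2 * t * Y + t\<^sup>2 * Z \<le> Z - 2 * t * Y" by simp
    moreover have "0 \<le> 2 * t * Y" using t \<open>Y \<ge> 0\<close> by simp
    ultimately show False using h[of t] t z by linarith
  qed
  show "Y\<^sup>2 \<le> X * Z"
  proof (cases "Y = 0")
    case True thus ?thesis using Z \<open>X \<ge> 0\<close> by simp
  next
    case False
    hence Y: "Y > 0" using \<open>Y \<ge> 0\<close> by simp
    have "Z \<noteq> 0"
    proof
      assume "Z = 0"
      \<comment> \<open>This t makes the linear term equal to \<open>X + 1\<close>, so the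
        expression takes the value -1.\<close>
      with h[of "(X + 1) / (2 * Y)"] Y \<open>X \<ge> 0\<close> show False by (simp add: field_simps)
    qed
    hence "Z > 0" using Z by simp
    with h[of "Y / Z"] Y show ?thesis by (simp add: field_simps power2_eq_square)
  qed
qed

lemma wint_Cauchy_Schwarz:
  assumes "wl2 p \<phi>" "wl2 p \<psi>"
  shows "\<bar>pos_int (\<lambda>x. \<phi> x * \<psi> x * x powr p)\<bar> \<le> sqrt (wint p \<phi>) * sqrt (wint p \<psi>)"
proof -
  let ?Y = "pos_int (\<lambda>x. \<phi> x * \<psi> x * x powr p)"
  define \<sigma> :: real where "\<sigma> = (if ?Y \<ge> 0 then 1 else -1)"
  have "0 \<le> wint p \<phi> - 2 * t * \<bar>?Y\<bar> + t\<^sup>2 * wint p \<psi>" for t :: real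
  proof -
    have "0 \<le> wint p (\<lambda>x. \<phi> x - \<sigma> * t * \<psi> x)" by (rule wint_nonneg)
    also have "\<dots> = wint p \<phi> - 2 * (\<sigma> * t * ?Y) + (\<sigma> * t)\<^sup>2 * wint p \<psi>"
      using wl2_diff(2)[OF assms(1) wl2_scale[OF assms(2), of "\<sigma> * t"]]
      by (simp add: wint_scale mult.left_commute[of _ "\<sigma> * t"] mult.assoc[of "\<sigma> * t"])
    also have "\<dots> = wint p \<phi> - 2 * t * \<bar>?Y\<bar> + t\<^sup>2 * wint p \<psi>"
      by (simp add: \<sigma>_def)
    finally show ?thesis .
  qed
  from quadratic_nonneg_imp(2)[OF this wint_nonneg] have "\<bar>?Y\<bar>\<^sup>2 \<le> wint p \<phi> * wint p \<psi>" by simp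
  hence "\<bar>?Y\<bar> \<le> sqrt (wint p \<phi> * wint p \<psi>)" by (rule real_le_rsqrt)
  thus ?thesis by (simp add: real_sqrt_mult)
qed

text \<open>The reverse triangle inequality. It makes the square root of each weighted integral
  Lipschitz in the norm, which is what extends the functionals to Cauchy sequences.\<close>

lemma wint_triangle:
  assumes "wl2 p \<phi>" "wl2 p \<psi>"
  shows "\<bar>sqrt (wint p \<phi>) - sqrt (wint p \<psi>)\<bar> \<le> sqrt (wint p (\<lambda>x. \<phi> x - \<psi> x))"
proof (rule real_le_rsqrt)
  have "\<bar>sqrt (wint p \<phi>) - sqrt (wint p \<psi>)\<bar>\<^sup>2 =
      wint p \<phi> - 2 * (sqrt (wint p \<phi>) * sqrt (wint p \<psi>)) + wint p \<psi>"
    by (simp add: power2_eq_square algebra_simps wint_nonneg)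
  also have "\<dots> \<le> wint p (\<lambda>x. \<phi> x - \<psi> x)"
    using wl2_diff(2)[OF assms] wint_Cauchy_Schwarz[OF assms] by simp
  finally show "\<bar>sqrt (wint p \<phi>) - sqrt (wint p \<psi>)\<bar>\<^sup>2 \<le> wint p (\<lambda>x. \<phi> x - \<psi> x)" .
qed

section \<open>The spaces Dpre and Dmu\<close>

lemma smooth_pos_DERIV:
  assumes "smooth_pos g" "x > 0"
  shows "((deriv ^^ k) g has_real_derivative deriv ((deriv ^^ k) g) x) (at x)"
  using assms by (auto simp: smooth_pos_def DERIV_deriv_iff_real_differentiable)

lemma smooth_pos_DERIVs:
  assumes "smooth_pos g" "x > 0"
  shows "(g has_real_derivative deriv g x) (at x)"
    "(deriv g has_real_derivative deriv (deriv g) x) (at x)"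
    "(deriv (deriv g) has_real_derivative deriv (deriv (deriv g)) x) (at x)"
  using smooth_pos_DERIV[OF assms, of 0] smooth_pos_DERIV[OF assms, of 1]
    smooth_pos_DERIV[OF assms, of 2] by (simp_all add: numeral_2_eq_2)

lemma smooth_pos_continuous_on:
  assumes "smooth_pos g"
  shows "continuous_on {0<..} ((deriv ^^ k) g)"
  using smooth_pos_DERIV[OF assms] by (intro continuous_at_imp_continuous_on) (auto intro: DERIV_isCont)

lemma smooth_pos_continuous_ons:
  assumes "smooth_pos g"
  shows "continuous_on {0<..} g" "continuous_on {0<..} (deriv g)"
    "continuous_on {0<..} (deriv (deriv g))" "continuous_on {0<..} (deriv (deriv (deriv g)))"
  using smooth_pos_continuous_on[OF assms, of 0] smooth_pos_continuous_on[OF assms, of 1]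
    smooth_pos_continuous_on[OF assms, of 2] smooth_pos_continuous_on[OF assms, of 3]
  by (simp_all add: numeral_2_eq_2 numeral_3_eq_3)

section \<open>Closure of the function spaces under differences\<close>

lemma funpow_deriv_diff:
  assumes f: "smooth_pos f" and g: "smooth_pos g" and "x > 0"
  shows "(deriv ^^ k) (f - g) x = (deriv ^^ k) f x - (deriv ^^ k) g x"
    and "((deriv ^^ k) (f - g) has_real_derivative (deriv ^^ Suc k) f x - (deriv ^^ Suc k) g x) (at x)"
proof -
  have "\<forall>x>0. (deriv ^^ k) (f - g) x = (deriv ^^ k) f x - (deriv ^^ k) g x \<and>
    ((deriv ^^ k) (f - g) has_real_derivative (deriv ^^ Suc k) f x - (deriv ^^ Suc k) g x) (at x)"
  proof (induction k)
    case 0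
    show ?case using smooth_pos_DERIV[OF f, of _ 0] smooth_pos_DERIV[OF g, of _ 0]
      by (auto simp: fun_diff_def intro!: DERIV_diff)
  next
    case (Suc k)
    have eq: "(deriv ^^ Suc k) (f - g) x = (deriv ^^ Suc k) f x - (deriv ^^ Suc k) g x" if "x > 0" for x
      using DERIV_imp_deriv[OF conjunct2[OF Suc[rule_format, OF that]]] by (simp only: funpow.simps o_apply)
    have "((deriv ^^ Suc k) (f - g) has_real_derivative
        (deriv ^^ Suc (Suc k)) f x - (deriv ^^ Suc (Suc k)) g x) (at x)" if "x > 0" for x
    \<comment> \<open>The identity at order \<open>Suc k\<close> is known only on the half-line, so
      the derivative is transported along an equality on an open set.\<close>
    proof (rule has_field_derivative_transform_within_open[where S = "{0<..}"])
      show "((\<lambda>x. (deriv ^^ Suc k) f x - (deriv ^^ Suc k) g x) has_real_derivative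
          (deriv ^^ Suc (Suc k)) f x - (deriv ^^ Suc (Suc k)) g x) (at x)"
        using smooth_pos_DERIV[OF f that, of "Suc k"] smooth_pos_DERIV[OF g that, of "Suc k"]
        by (intro DERIV_diff) simp_all
    qed (use that eq in auto)
    with eq show ?case by blast
  qed
  with \<open>x > 0\<close> show "(deriv ^^ k) (f - g) x = (deriv ^^ k) f x - (deriv ^^ k) g x"
    "((deriv ^^ k) (f - g) has_real_derivative (deriv ^^ Suc k) f x - (deriv ^^ Suc k) g x) (at x)"
    by auto
qed

lemma smooth_pos_diff:
  assumes "smooth_pos f" "smooth_pos g"
  shows "smooth_pos (f - g)"
  using funpow_deriv_diff(2)[OF assms] unfolding smooth_pos_def
  by (auto simp: real_differentiable_def)

lemma derivs_diff:
  assumes "smooth_pos f" "smooth_pos g" "x > 0"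
  shows "deriv (f - g) x = deriv f x - deriv g x"
    "deriv (deriv (f - g)) x = deriv (deriv f) x - deriv (deriv g) x"
  using funpow_deriv_diff(1)[OF assms, of 1] funpow_deriv_diff(1)[OF assms, of 2]
  by (simp_all add: numeral_2_eq_2)

lemma Cinf_mu_bounded_near_0:
  assumes "g \<in> Cinf_mu \<mu>"
  obtains M where "\<forall>\<^sub>F x in at_right 0. \<bar>g x\<bar> \<le> M \<and> \<bar>deriv g x\<bar> \<le> M"
proof -
  from assms obtain M where M: "Limsup (at_right 0) (\<lambda>x. ereal (\<bar>g x\<bar> + \<bar>deriv g x\<bar>)) < ereal M"
    using less_PInf_Ex_of_nat[of "Limsup (at_right 0) (\<lambda>x. ereal (\<bar>g x\<bar> + \<bar>deriv g x\<bar>))"]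
    by (auto simp: Cinf_mu_def)
  have "\<forall>\<^sub>F x in at_right 0. \<bar>g x\<bar> \<le> M \<and> \<bar>deriv g x\<bar> \<le> M"
    using Limsup_lessD[OF M] by eventually_elim auto
  thus ?thesis by (rule that)
qed

lemma Cinf_mu_diff:
  assumes f: "f \<in> Cinf_mu \<mu>" and g: "g \<in> Cinf_mu \<mu>"
  shows "f - g \<in> Cinf_mu \<mu>"
proof -
  have s: "smooth_pos f" "smooth_pos g" using assms by (auto simp: Cinf_mu_def)
  obtain M where M: "\<forall>\<^sub>F x in at_right 0. \<bar>f x\<bar> \<le> M \<and> \<bar>deriv f x\<bar> \<le> M"
    by (rule Cinf_mu_bounded_near_0[OF f])
  obtain N where N: "\<forall>\<^sub>F x in at_right 0. \<bar>g x\<bar> \<le> N \<and> \<bar>deriv g x\<bar> \<le> N"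
    by (rule Cinf_mu_bounded_near_0[OF g])
  have "Limsup (at_right 0) (\<lambda>x. ereal (\<bar>(f - g) x\<bar> + \<bar>deriv (f - g) x\<bar>)) \<le> ereal (2 * M + 2 * N)"
  proof (rule Limsup_bounded)
    show "\<forall>\<^sub>F x in at_right 0. ereal (\<bar>(f - g) x\<bar> + \<bar>deriv (f - g) x\<bar>) \<le> ereal (2 * M + 2 * N)"
      using M N eventually_at_right_less[of 0]
      by eventually_elim (auto simp: derivs_diff[OF s])
  qed
  moreover have "((\<lambda>x. x powr (\<mu>+1) * (deriv (f - g) x)\<^sup>2 + x powr \<mu> * ((f - g) x)\<^sup>2) \<longlongrightarrow> 0) at_top"
  proof (rule tendsto_sandwich[OF _ _ tendsto_const])
    let ?h = "\<lambda>g x. x powr (\<mu>+1) * (deriv g x)\<^sup>2 + x powr \<mu> * (g x)\<^sup>2"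
    show "((\<lambda>x. 2 * (?h f x + ?h g x)) \<longlongrightarrow> 0) at_top"
      by (rule tendsto_mult_right_zero, rule tendsto_add_zero) (use assms in \<open>auto simp: Cinf_mu_def\<close>)
    have sq: "(a - b)\<^sup>2 \<le> 2 * a\<^sup>2 + 2 * b\<^sup>2" for a b :: real
      using zero_le_power2[of "a + b"] by (simp add: power2_eq_square algebra_simps)
    show "\<forall>\<^sub>F x in at_top. ?h (f - g) x \<le> 2 * (?h f x + ?h g x)"
      using eventually_gt_at_top[of 0]
    proof eventually_elim
      case (elim x)
      have "x powr (\<mu>+1) * (deriv f x - deriv g x)\<^sup>2 \<le> x powr (\<mu>+1) * (2 * (deriv f x)\<^sup>2 + 2 * (deriv g x)\<^sup>2)"
        "x powr \<mu> * (f x - g x)\<^sup>2 \<le> x powr \<mu> * (2 * (f x)\<^sup>2 + 2 * (g x)\<^sup>2)"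
        by (intro mult_left_mono sq; simp)+
      thus ?case using elim by (simp add: derivs_diff[OF s] algebra_simps)
    qed
  qed (auto intro!: always_eventually)
  ultimately show ?thesis using smooth_pos_diff[OF s] by (auto simp: Cinf_mu_def)
qed

lemma Dpre_smooth: "g \<in> Dpre \<mu> \<Longrightarrow> smooth_pos g"
  by (simp add: Dpre_def Cinf_mu_def)

section \<open>The norm as a sum of weighted square integrals\<close>

lemma pos_integrable_weight_iff:
  assumes "continuous_on {0<..} \<phi>"
  shows "pos_integrable (\<lambda>x. (\<phi> x)\<^sup>2 * (x+1) * x powr \<mu>) \<longleftrightarrow> wl2 (\<mu>+1) \<phi> \<and> wl2 \<mu> \<phi>"
proof -
  have e: "(\<phi> x)\<^sup>2 * (x+1) * x powr \<mu> = (\<phi> x)\<^sup>2 * x powr (\<mu>+1) + (\<phi> x)\<^sup>2 * x powr \<mu>" if "x > 0" for x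
    using that by (simp add: powr_add algebra_simps)
  have "wl2 (\<mu>+1) \<phi> \<and> wl2 \<mu> \<phi>" if h: "pos_integrable (\<lambda>x. (\<phi> x)\<^sup>2 * (x+1) * x powr \<mu>)"
    unfolding wl2_def
    by (intro conjI assms; rule pos_integrable_bound[OF h])
       (use assms in \<open>auto simp: e intro!: continuous_intros\<close>)
  moreover have "pos_integrable (\<lambda>x. (\<phi> x)\<^sup>2 * (x+1) * x powr \<mu>)" if "wl2 (\<mu>+1) \<phi> \<and> wl2 \<mu> \<phi>"
    using that pos_integrable_cong[of "\<lambda>x. (\<phi> x)\<^sup>2 * (x+1) * x powr \<mu>"
      "\<lambda>x. (\<phi> x)\<^sup>2 * x powr (\<mu>+1) + (\<phi> x)\<^sup>2 * x powr \<mu>"] e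
    by (auto simp: wl2_def)
  ultimately show ?thesis by blast
qed

lemma Dpre_iff:
  "g \<in> Dpre \<mu> \<longleftrightarrow> g \<in> Cinf_mu \<mu> \<and> wl2 (\<mu>+1) (deriv (deriv g)) \<and>
    wl2 (\<mu>+1) (deriv g) \<and> wl2 \<mu> (deriv g) \<and> wl2 (\<mu>-1) g"
proof (cases "g \<in> Cinf_mu \<mu>")
  case True
  hence "smooth_pos g" by (simp add: Cinf_mu_def)
  note c = smooth_pos_continuous_ons[OF this]
  show ?thesis using True pos_integrable_weight_iff[OF c(2)] c
    by (auto simp: Dpre_def wl2_def)
qed (simp add: Dpre_def)

lemma Dnorm2_eq:
  assumes "g \<in> Dpre \<mu>"
  shows "Dnorm2 \<mu> g = 4 * wint (\<mu>+1) (deriv (deriv g)) + wint (\<mu>+1) (deriv g)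
    + wint \<mu> (deriv g) + wint (\<mu>-1) g"
proof -
  have "pos_int (\<lambda>x. (deriv g x)\<^sup>2 * (x+1) * x powr \<mu>) =
      pos_int (\<lambda>x. (deriv g x)\<^sup>2 * x powr (\<mu>+1) + (deriv g x)\<^sup>2 * x powr \<mu>)"
    by (rule pos_int_cong) (simp add: powr_add algebra_simps)
  also have "\<dots> = wint (\<mu>+1) (deriv g) + wint \<mu> (deriv g)"
    using assms by (simp add: Dpre_iff wl2_def wint_def)
  finally show ?thesis by (simp add: Dnorm2_def wint_def)
qed

lemma Dpre_diff:
  assumes "f \<in> Dpre \<mu>" "g \<in> Dpre \<mu>"
  shows "f - g \<in> Dpre \<mu>"
proof -
  note s = Dpre_smooth[OF assms(1)] Dpre_smooth[OF assms(2)]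
  have "wl2 p (deriv (deriv (f - g))) = wl2 p (\<lambda>x. deriv (deriv f) x - deriv (deriv g) x)"
    "wl2 p (deriv (f - g)) = wl2 p (\<lambda>x. deriv f x - deriv g x)"
    "wl2 p (f - g) = wl2 p (\<lambda>x. f x - g x)" for p
    by (rule wl2_cong; simp add: derivs_diff[OF s])+
  thus ?thesis using assms Cinf_mu_diff by (auto simp: Dpre_iff intro!: wl2_diff(1))
qed

lemma Dnorm2_nonneg: "g \<in> Dpre \<mu> \<Longrightarrow> 0 \<le> Dnorm2 \<mu> g"
  by (simp add: Dnorm2_eq wint_nonneg)

lemma wint_le_Dnorm:
  assumes "g \<in> Dpre \<mu>"
  shows "sqrt (wint (\<mu>+1) (deriv (deriv g))) \<le> Dnorm \<mu> g"
    "sqrt (wint (\<mu>+1) (deriv g)) \<le> Dnorm \<mu> g" "sqrt (wint \<mu> (deriv g)) \<le> Dnorm \<mu> g"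
    "sqrt (wint (\<mu>-1) g) \<le> Dnorm \<mu> g"
  using assms wint_nonneg[of "\<mu>+1" "deriv (deriv g)"] wint_nonneg[of "\<mu>+1" "deriv g"]
    wint_nonneg[of "\<mu>" "deriv g"] wint_nonneg[of "\<mu>-1" g]
  by (auto simp: Dnorm_def Dnorm2_eq)

lemma wint_le_Dnorm_diff:
  assumes "f \<in> Dpre \<mu>" "g \<in> Dpre \<mu>"
  shows "sqrt (wint (\<mu>+1) (\<lambda>x. deriv (deriv f) x - deriv (deriv g) x)) \<le> Dnorm \<mu> (f - g)"
    "sqrt (wint (\<mu>+1) (\<lambda>x. deriv f x - deriv g x)) \<le> Dnorm \<mu> (f - g)"
    "sqrt (wint \<mu> (\<lambda>x. deriv f x - deriv g x)) \<le> Dnorm \<mu> (f - g)"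
    "sqrt (wint (\<mu>-1) (\<lambda>x. f x - g x)) \<le> Dnorm \<mu> (f - g)"
proof -
  note s = Dpre_smooth[OF assms(1)] Dpre_smooth[OF assms(2)]
  have e: "wint p (deriv (deriv (f - g))) = wint p (\<lambda>x. deriv (deriv f) x - deriv (deriv g) x)"
    "wint p (deriv (f - g)) = wint p (\<lambda>x. deriv f x - deriv g x)"
    "wint p (f - g) = wint p (\<lambda>x. f x - g x)" for p
    by (rule wint_cong; simp add: derivs_diff[OF s])+
  show "sqrt (wint (\<mu>+1) (\<lambda>x. deriv (deriv f) x - deriv (deriv g) x)) \<le> Dnorm \<mu> (f - g)"
    "sqrt (wint (\<mu>+1) (\<lambda>x. deriv f x - deriv g x)) \<le> Dnorm \<mu> (f - g)"
    "sqrt (wint \<mu> (\<lambda>x. deriv f x - deriv g x)) \<le> Dnorm \<mu> (f - g)"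
    "sqrt (wint (\<mu>-1) (\<lambda>x. f x - g x)) \<le> Dnorm \<mu> (f - g)"
    using wint_le_Dnorm[OF Dpre_diff[OF assms]] by (simp_all add: e)
qed

lemma eps_integral_eq:
  assumes "g \<in> Dpre \<mu>"
  shows "pos_int (\<lambda>x. (x\<^sup>2 * (deriv g x)\<^sup>2 - \<epsilon> * (g x)\<^sup>2) * x powr (\<mu>-1)) =
    wint (\<mu>+1) (deriv g) - \<epsilon> * wint (\<mu>-1) g"
proof -
  have "pos_int (\<lambda>x. (x\<^sup>2 * (deriv g x)\<^sup>2 - \<epsilon> * (g x)\<^sup>2) * x powr (\<mu>-1)) =
      pos_int (\<lambda>x. (deriv g x)\<^sup>2 * x powr (\<mu>+1) - \<epsilon> * ((g x)\<^sup>2 * x powr (\<mu>-1)))"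
  proof (rule pos_int_cong)
    fix x :: real assume "x > 0"
    hence "x powr (\<mu>+1) = x\<^sup>2 * x powr (\<mu>-1)"
      by (simp add: powr_add powr_diff power2_eq_square)
    thus "(x\<^sup>2 * (deriv g x)\<^sup>2 - \<epsilon> * (g x)\<^sup>2) * x powr (\<mu>-1) =
        (deriv g x)\<^sup>2 * x powr (\<mu>+1) - \<epsilon> * ((g x)\<^sup>2 * x powr (\<mu>-1))"
      by (simp add: algebra_simps)
  qed
  also have "\<dots> = wint (\<mu>+1) (deriv g) - \<epsilon> * wint (\<mu>-1) g"
    using assms unfolding wint_def by (subst set_integral_diff(2)) (auto simp: Dpre_iff wl2_def)
  finally show ?thesis .
qed

text \<open>These are the boundary terms at infinity of the integration by parts for
  \<open>kummer_op\<close>. The definition supplies the first two; the third follows from x powr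
  \<mu> \<le> x powr (\<mu>+1) for x \<ge> 1, the mixed one from |u v| \<le> u^2 + v^2.\<close>

lemma Cinf_mu_limits:
  assumes "g \<in> Cinf_mu \<mu>"
  shows "((\<lambda>x. x powr (\<mu>+1) * (deriv g x)\<^sup>2) \<longlongrightarrow> 0) at_top"
    "((\<lambda>x. x powr \<mu> * (g x)\<^sup>2) \<longlongrightarrow> 0) at_top"
    "((\<lambda>x. x powr \<mu> * (deriv g x)\<^sup>2) \<longlongrightarrow> 0) at_top"
    "((\<lambda>x. x powr \<mu> * (g x * deriv g x)) \<longlongrightarrow> 0) at_top"
proof -
  have l: "((\<lambda>x. x powr (\<mu>+1) * (deriv g x)\<^sup>2 + x powr \<mu> * (g x)\<^sup>2) \<longlongrightarrow> 0) at_top"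
    using assms by (simp add: Cinf_mu_def)
  show 1: "((\<lambda>x. x powr (\<mu>+1) * (deriv g x)\<^sup>2) \<longlongrightarrow> 0) at_top"
    by (rule tendsto_sandwich[OF _ _ tendsto_const l]) (auto intro!: always_eventually)
  show 2: "((\<lambda>x. x powr \<mu> * (g x)\<^sup>2) \<longlongrightarrow> 0) at_top"
    by (rule tendsto_sandwich[OF _ _ tendsto_const l]) (auto intro!: always_eventually)
  show 3: "((\<lambda>x. x powr \<mu> * (deriv g x)\<^sup>2) \<longlongrightarrow> 0) at_top"
  proof (rule tendsto_sandwich[OF _ _ tendsto_const 1])
    show "\<forall>\<^sub>F x in at_top. x powr \<mu> * (deriv g x)\<^sup>2 \<le> x powr (\<mu>+1) * (deriv g x)\<^sup>2"
      using eventually_ge_at_top[of 1]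
      by eventually_elim (auto intro!: mult_right_mono powr_mono)
  qed (auto intro!: always_eventually)
  show "((\<lambda>x. x powr \<mu> * (g x * deriv g x)) \<longlongrightarrow> 0) at_top"
  proof (rule Lim_null_comparison[OF always_eventually])
    show "((\<lambda>x. x powr \<mu> * (g x)\<^sup>2 + x powr \<mu> * (deriv g x)\<^sup>2) \<longlongrightarrow> 0) at_top"
      by (rule tendsto_add_zero[OF 2 3])
    show "\<forall>x. norm (x powr \<mu> * (g x * deriv g x)) \<le> x powr \<mu> * (g x)\<^sup>2 + x powr \<mu> * (deriv g x)\<^sup>2"
    proof
      fix x
      have "\<bar>g x * deriv g x\<bar> \<le> (g x)\<^sup>2 + (deriv g x)\<^sup>2"
        using sum_squares_bound[of "\<bar>g x\<bar>" "\<bar>deriv g x\<bar>"] abs_ge_zero[of "g x * deriv g x"]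
        unfolding abs_mult power2_abs by linarith
      hence "x powr \<mu> * \<bar>g x * deriv g x\<bar> \<le> x powr \<mu> * ((g x)\<^sup>2 + (deriv g x)\<^sup>2)"
        by (rule mult_left_mono) simp
      thus "norm (x powr \<mu> * (g x * deriv g x)) \<le> x powr \<mu> * (g x)\<^sup>2 + x powr \<mu> * (deriv g x)\<^sup>2"
        by (simp add: abs_mult distrib_left)
    qed
  qed
qed

lemma powr_tendsto_0_at_right:
  assumes "r > 0"
  shows "((\<lambda>x::real. x powr r) \<longlongrightarrow> 0) (at_right 0)"
proof -
  have "((\<lambda>x::real. x powr r) \<longlongrightarrow> 0 powr r) (at_right 0)"
    by (rule tendsto_powr') (use assms eventually_at_right_less[of 0] in \<open>auto elim: eventually_mono\<close>)
  thus ?thesis by simp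
qed

text \<open>Boundedness near 0 is played against a vanishing power of x. The quadratic limits serve
  the integration by parts, the linear ones the Wronskian.\<close>

lemma Cinf_mu_limits_0:
  assumes "g \<in> Cinf_mu \<mu>" "r > 0"
  shows "((\<lambda>x. x powr r * (deriv g x)\<^sup>2) \<longlongrightarrow> 0) (at_right 0)"
    "((\<lambda>x. x powr r * (g x)\<^sup>2) \<longlongrightarrow> 0) (at_right 0)"
    "((\<lambda>x. x powr r * (g x * deriv g x)) \<longlongrightarrow> 0) (at_right 0)"
    "((\<lambda>x. x powr r * deriv g x) \<longlongrightarrow> 0) (at_right 0)"
    "((\<lambda>x. x powr r * g x) \<longlongrightarrow> 0) (at_right 0)"
proof -
  obtain M where M: "\<forall>\<^sub>F x in at_right 0. \<bar>g x\<bar> \<le> M \<and> \<bar>deriv g x\<bar> \<le> M"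
    by (rule Cinf_mu_bounded_near_0[OF assms(1)])
  note l = lim_null_mult_right_bounded[OF powr_tendsto_0_at_right[OF assms(2)]]
  have m: "\<bar>u * v\<bar> \<le> M * M" if "\<bar>u\<bar> \<le> M" "\<bar>v\<bar> \<le> M" for u v :: real
    unfolding abs_mult using that by (intro mult_mono') auto
  have m2: "u * u \<le> M * M" if "\<bar>u\<bar> \<le> M" for u :: real
    using m[OF that that] by simp
  have b: "\<forall>\<^sub>F x in at_right 0. norm ((deriv g x)\<^sup>2) \<le> M * M"
    "\<forall>\<^sub>F x in at_right 0. norm ((g x)\<^sup>2) \<le> M * M"
    "\<forall>\<^sub>F x in at_right 0. norm (g x * deriv g x) \<le> M * M"
    by (rule eventually_mono[OF M]; simp add: m m2 power2_eq_square)+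
  have c: "\<forall>\<^sub>F x in at_right 0. norm (deriv g x) \<le> M" "\<forall>\<^sub>F x in at_right 0. norm (g x) \<le> M"
    by (rule eventually_mono[OF M]; simp)+
  show "((\<lambda>x. x powr r * (deriv g x)\<^sup>2) \<longlongrightarrow> 0) (at_right 0)"
    "((\<lambda>x. x powr r * (g x)\<^sup>2) \<longlongrightarrow> 0) (at_right 0)"
    "((\<lambda>x. x powr r * (g x * deriv g x)) \<longlongrightarrow> 0) (at_right 0)"
    "((\<lambda>x. x powr r * deriv g x) \<longlongrightarrow> 0) (at_right 0)"
    "((\<lambda>x. x powr r * g x) \<longlongrightarrow> 0) (at_right 0)"
    using l[OF b(1)] l[OF b(2)] l[OF b(3)] l[OF c(1)] l[OF c(2)] by auto
qed

section \<open>The inequality on Dpre\<close>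

text \<open>For \<open>lam = 1\<close> this is, up to sign, Kummer's operator with parameters a and
  \<mu> after the reflection of x to -x; \<open>lam\<close> rescales the variable.\<close>

definition kummer_op :: "real \<Rightarrow> real \<Rightarrow> real \<Rightarrow> (real \<Rightarrow> real) \<Rightarrow> real \<Rightarrow> real" where
  "kummer_op \<mu> a lam g x = x * deriv (deriv g) x + (\<mu> + lam * x) * deriv g x + a * lam * g x"

text \<open>In the expanded square every mixed product belongs to an exact derivative, and only
  squares remain. The term \<mu>^2 x powr (\<mu>-1) (g')^2, which the norm does not contain,
  cancels. Integrability of the square comes out as a by-product.\<close>

lemma wint_kummer_op:
  assumes mu: "\<mu> > 0" and g: "g \<in> Dpre \<mu>"
  shows "wl2 (\<mu>-1) (kummer_op \<mu> a lam g)"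
    and "wint (\<mu>-1) (kummer_op \<mu> a lam g) = wint (\<mu>+1) (deriv (deriv g))
      + lam\<^sup>2 * (wint (\<mu>+1) (deriv g) + a * (a - \<mu>) * wint (\<mu>-1) g)
      - lam * (2 * a - \<mu> + 1) * wint \<mu> (deriv g)"
proof -
  have s: "smooth_pos g" and ci: "g \<in> Cinf_mu \<mu>" using g by (auto simp: Dpre_def Cinf_mu_def)
  note c = smooth_pos_continuous_ons[OF s]
  note D = smooth_pos_DERIVs[OF s]
  let ?f = "\<lambda>x. (kummer_op \<mu> a lam g x)\<^sup>2 * x powr (\<mu>-1)"
  let ?h = "\<lambda>x. (deriv (deriv g) x)\<^sup>2 * x powr (\<mu>+1)
      + lam\<^sup>2 * ((deriv g x)\<^sup>2 * x powr (\<mu>+1)) + lam\<^sup>2 * (a * (a - \<mu>)) * ((g x)\<^sup>2 * x powr (\<mu>-1))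
      - lam * (2 * a - \<mu> + 1) * ((deriv g x)\<^sup>2 * x powr \<mu>)"
  \<comment> \<open>The first two summands cancel the products g' g'', the third cancels g g''
    together with the part of g g' that has the factor \<mu>, and the fourth the rest of g
    g'.\<close>
  let ?F = "\<lambda>x. \<mu> * (x powr \<mu> * (deriv g x)\<^sup>2) + lam * (x powr (\<mu>+1) * (deriv g x)\<^sup>2)
      + 2 * a * lam * (x powr \<mu> * (g x * deriv g x)) + a * lam\<^sup>2 * (x powr \<mu> * (g x)\<^sup>2)"
  have ck: "continuous_on {0<..} (kummer_op \<mu> a lam g)"
    unfolding kummer_op_def by (intro continuous_intros c)
  have cf: "continuous_on {0<..} ?f"
    using ck by (auto intro!: continuous_intros)
  have ch: "continuous_on {0<..} ?h"
    by (auto intro!: continuous_intros c)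
  have int: "pos_integrable (\<lambda>x. (deriv (deriv g) x)\<^sup>2 * x powr (\<mu>+1))"
    "pos_integrable (\<lambda>x. (deriv g x)\<^sup>2 * x powr (\<mu>+1))"
    "pos_integrable (\<lambda>x. (g x)\<^sup>2 * x powr (\<mu>-1))"
    "pos_integrable (\<lambda>x. (deriv g x)\<^sup>2 * x powr \<mu>)"
    using g by (auto simp: Dpre_iff wl2_def)
  have hi: "pos_integrable ?h"
    by (intro set_integral_add(1) set_integral_diff(1) set_integrable_mult_right int)
  have d: "(?F has_real_derivative (?f x - ?h x)) (at x)" if "x > 0" for x
  proof -
    have e: "x powr \<mu> = x * x powr (\<mu>-1)" "x powr (\<mu>+1) = x * x * x powr (\<mu>-1)"
      "x powr (1+\<mu>) = x * x * x powr (\<mu>-1)"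
      using that by (simp_all add: powr_add powr_diff)
    show ?thesis using that
      by (auto intro!: derivative_eq_intros D has_real_derivative_powr
          simp: e kummer_op_def power2_eq_square algebra_simps)
  qed
  have l0: "(?F \<longlongrightarrow> 0) (at_right 0)"
    by (intro tendsto_add_zero tendsto_mult_right_zero Cinf_mu_limits_0[OF ci]) (use mu in auto)
  have l1: "(?F \<longlongrightarrow> 0) at_top"
    by (intro tendsto_add_zero tendsto_mult_right_zero Cinf_mu_limits[OF ci])
  note r = pos_int_eq_FTC[OF cf ch _ hi d l0 l1]
  show "wl2 (\<mu>-1) (kummer_op \<mu> a lam g)" using r(1) ck by (simp add: wl2_def)
  have "wint (\<mu>-1) (kummer_op \<mu> a lam g) = pos_int ?h" using r(2) by (simp add: wint_def)
  also have "\<dots> = wint (\<mu>+1) (deriv (deriv g)) + lam\<^sup>2 * wint (\<mu>+1) (deriv g)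
      + lam\<^sup>2 * (a * (a - \<mu>)) * wint (\<mu>-1) g - lam * (2 * a - \<mu> + 1) * wint \<mu> (deriv g)"
    unfolding wint_def
    by (simp only: set_integral_add set_integral_diff set_integrable_mult_right int set_integral_mult_right)
  finally show "wint (\<mu>-1) (kummer_op \<mu> a lam g) = wint (\<mu>+1) (deriv (deriv g))
      + lam\<^sup>2 * (wint (\<mu>+1) (deriv g) + a * (a - \<mu>) * wint (\<mu>-1) g)
      - lam * (2 * a - \<mu> + 1) * wint \<mu> (deriv g)"
    by (simp add: algebra_simps)
qed

text \<open>The discriminant criterion applied to the preceding identity as a quadratic in
  \<open>lam\<close>. The free parameter a is used twice: the larger root gives the sharp
  inequality, and a = \<mu>/2 gives Hardy's inequality with constant \<mu>^2/4.\<close>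

lemma Dpre_inequality:
  assumes mu: "\<mu> > 0" and g: "g \<in> Dpre \<mu>" and a: "2 * a - \<mu> + 1 \<ge> 0"
  defines "B \<equiv> wint (\<mu>+1) (deriv g) + a * (a - \<mu>) * wint (\<mu>-1) g"
  shows "B \<ge> 0"
    and "((2 * a - \<mu> + 1) / 2 * wint \<mu> (deriv g))\<^sup>2 \<le> wint (\<mu>+1) (deriv (deriv g)) * B"
proof -
  have "0 \<le> wint (\<mu>+1) (deriv (deriv g)) - 2 * t * ((2 * a - \<mu> + 1) / 2 * wint \<mu> (deriv g)) + t\<^sup>2 * B"
    for t
  proof -
    have "2 * t * ((2 * a - \<mu> + 1) / 2 * wint \<mu> (deriv g)) = t * (2 * a - \<mu> + 1) * wint \<mu> (deriv g)"
      by (simp add: field_simps)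
    thus ?thesis
      using wint_nonneg[of "\<mu>-1" "kummer_op \<mu> a t g"] unfolding wint_kummer_op(2)[OF mu g] B_def
      by linarith
  qed
  note q = quadratic_nonneg_imp[OF this wint_nonneg mult_nonneg_nonneg[OF _ wint_nonneg]]
  show "B \<ge> 0" "((2 * a - \<mu> + 1) / 2 * wint \<mu> (deriv g))\<^sup>2 \<le> wint (\<mu>+1) (deriv (deriv g)) * B"
    using q a by auto
qed

text \<open>Integrate the derivative of x powr r * \<phi>^2 from x to R and let R tend to infinity.
  As r \<ge> 0, the derivative of the weight has a favourable sign and is dropped; the rest is
  Cauchy-Schwarz in parametric form.\<close>

lemma weighted_pointwise_bound:
  assumes D: "\<And>x. x > 0 \<Longrightarrow> (\<phi> has_real_derivative \<phi>' x) (at x)"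
    and w: "wl2 p \<phi>" "wl2 q \<phi>'" and r: "r = (p + q) / 2" "r \<ge> 0"
    and lim: "((\<lambda>x. x powr r * (\<phi> x)\<^sup>2) \<longlongrightarrow> 0) at_top" and x: "x > 0"
  shows "x powr r * (\<phi> x)\<^sup>2 \<le> 2 * (sqrt (wint p \<phi>) * sqrt (wint q \<phi>'))"
proof -
  let ?Y = "x powr r * (\<phi> x)\<^sup>2 / 2"
  have "0 \<le> wint p \<phi> - 2 * t * ?Y + t\<^sup>2 * wint q \<phi>'" if t: "t > 0" for t
  proof -
    let ?h = "\<lambda>y. 1 / t * ((\<phi> y)\<^sup>2 * y powr p) + t * ((\<phi>' y)\<^sup>2 * y powr q)"
    have hi: "pos_integrable ?h" using w unfolding wl2_def
      by (intro set_integral_add(1) set_integrable_mult_right) auto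
    have b: "x powr r * (\<phi> x)\<^sup>2 - pos_int ?h \<le> R powr r * (\<phi> R)\<^sup>2" if R: "R \<ge> x" for R
    proof -
      have "- (R powr r * (\<phi> R)\<^sup>2) - - (x powr r * (\<phi> x)\<^sup>2) \<le> pos_int ?h"
      proof (rule FTC_le_pos_int[OF x R _ _ hi])
        fix y assume y: "x \<le> y" "y \<le> R"
        show "((\<lambda>y. - (y powr r * (\<phi> y)\<^sup>2)) has_real_derivative
            - (r * y powr (r - 1) * (\<phi> y)\<^sup>2 + y powr r * (2 * \<phi> y * \<phi>' y))) (at y)"
          using x y by (auto intro!: derivative_eq_intros D has_real_derivative_powr)
        define A where "A = \<phi> y * y powr (p/2)"
        define B where "B = \<phi>' y * y powr (q/2)"
        have e: "y powr r = y powr (p/2) * y powr (q/2)" "y powr p = (y powr (p/2))\<^sup>2" "y powr q = (y powr (q/2))\<^sup>2"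
          using r by (simp_all add: powr_add[symmetric] power2_eq_square add_divide_distrib)
        \<comment> \<open>This is -2 A B \<le> A^2 / t + t B^2, with the weight split so that A B
          carries y powr r.\<close>
        have "0 \<le> (A + t * B)\<^sup>2 / t" using t by simp
        also have "(A + t * B)\<^sup>2 / t = 1 / t * A\<^sup>2 + t * B\<^sup>2 + 2 * A * B"
          using t by (simp add: power2_eq_square field_simps)
        finally have "- (y powr r * (2 * \<phi> y * \<phi>' y)) \<le> ?h y"
          unfolding e A_def B_def by (simp add: power_mult_distrib mult_ac)
        moreover have "0 \<le> r * y powr (r - 1) * (\<phi> y)\<^sup>2" using r by simp
        ultimately show "- (r * y powr (r - 1) * (\<phi> y)\<^sup>2 + y powr r * (2 * \<phi> y * \<phi>' y)) \<le> ?h y"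
          by linarith
      next
        show "0 \<le> ?h y" for y using t by simp
      qed
      thus ?thesis by simp
    qed
    have "x powr r * (\<phi> x)\<^sup>2 - pos_int ?h \<le> 0"
      by (rule tendsto_lowerbound[OF lim eventually_mono[OF eventually_ge_at_top[of x] b]]) auto
    also have "pos_int ?h = 1 / t * wint p \<phi> + t * wint q \<phi>'"
      using w unfolding wl2_def wint_def
      by (subst set_integral_add(2)) auto
    finally have "t * (x powr r * (\<phi> x)\<^sup>2 - (1 / t * wint p \<phi> + t * wint q \<phi>')) \<le> t * 0"
      using t by (intro mult_left_mono) auto
    thus ?thesis using t by (simp add: algebra_simps power2_eq_square)
  qed
  from quadratic_nonneg_imp(2)[OF this wint_nonneg]
  have "?Y\<^sup>2 \<le> wint p \<phi> * wint q \<phi>'" by simp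
  hence "?Y \<le> sqrt (wint p \<phi> * wint q \<phi>')" by (rule real_le_rsqrt)
  thus ?thesis by (simp add: real_sqrt_mult)
qed

text \<open>The first bound makes point evaluation continuous in the norm. The second has the
  integral of (g')^2 x powr \<mu> as a factor, so a sequence along which that integral tends to 0
  has derivatives tending to 0 pointwise, provided the second-derivative integrals stay bounded. The
  exponent \<mu> + 1/2 is the mean of \<mu> and \<mu> + 1.\<close>

lemma Dpre_pointwise_bounds:
  assumes mu: "\<mu> > 0" and g: "g \<in> Dpre \<mu>" and x: "x > 0"
  shows "x powr \<mu> * (g x)\<^sup>2 \<le> 2 * (Dnorm \<mu> g)\<^sup>2"
    and "x powr (\<mu> + 1/2) * (deriv g x)\<^sup>2 \<le>
      2 * (sqrt (wint \<mu> (deriv g)) * sqrt (wint (\<mu>+1) (deriv (deriv g))))"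
proof -
  have s: "smooth_pos g" and ci: "g \<in> Cinf_mu \<mu>" using g by (auto simp: Dpre_def Cinf_mu_def)
  note D = smooth_pos_DERIVs[OF s]
  have w: "wl2 (\<mu>+1) (deriv (deriv g))" "wl2 (\<mu>+1) (deriv g)" "wl2 \<mu> (deriv g)" "wl2 (\<mu>-1) g"
    using g by (auto simp: Dpre_iff)
  have "x powr \<mu> * (g x)\<^sup>2 \<le> 2 * (sqrt (wint (\<mu>-1) g) * sqrt (wint (\<mu>+1) (deriv g)))"
    by (rule weighted_pointwise_bound[OF D(1) w(4,2)]) (use mu x Cinf_mu_limits[OF ci] in auto)
  also have "\<dots> \<le> 2 * (Dnorm \<mu> g * Dnorm \<mu> g)"
    using wint_le_Dnorm[OF g] order_trans[OF real_sqrt_ge_zero[OF wint_nonneg] wint_le_Dnorm(1)[OF g]]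
    by (intro mult_left_mono mult_mono) (auto simp: wint_nonneg)
  finally show "x powr \<mu> * (g x)\<^sup>2 \<le> 2 * (Dnorm \<mu> g)\<^sup>2" by (simp add: power2_eq_square)
  have "((\<lambda>x. x powr (\<mu>+1/2) * (deriv g x)\<^sup>2) \<longlongrightarrow> 0) at_top"
  proof (rule tendsto_sandwich[OF _ _ tendsto_const Cinf_mu_limits(1)[OF ci]])
    show "\<forall>\<^sub>F x in at_top. x powr (\<mu>+1/2) * (deriv g x)\<^sup>2 \<le> x powr (\<mu>+1) * (deriv g x)\<^sup>2"
      using eventually_ge_at_top[of 1]
      by eventually_elim (auto intro!: mult_right_mono powr_mono)
  qed (auto intro!: always_eventually)
  from weighted_pointwise_bound[OF D(2) w(3,1) _ _ this x]
  show "x powr (\<mu> + 1/2) * (deriv g x)\<^sup>2 \<le>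
      2 * (sqrt (wint \<mu> (deriv g)) * sqrt (wint (\<mu>+1) (deriv (deriv g))))"
    using mu by (simp add: field_simps)
qed

section \<open>Closability\<close>

lemma DmuD:
  assumes "s \<in> Dmu \<mu>"
  shows "s n \<in> Dpre \<mu>" "e > 0 \<Longrightarrow> \<exists>N. \<forall>m\<ge>N. \<forall>n\<ge>N. Dnorm \<mu> (s m - s n) < e"
  using assms by (auto simp: Dmu_def)

lemma convergent_of_sqrt_Dnorm_Cauchy:
  assumes s: "s \<in> Dmu \<mu>" and nn: "\<And>n. 0 \<le> c n"
    and le: "\<And>m n. \<bar>sqrt (c m) - sqrt (c n)\<bar> \<le> Dnorm \<mu> (s m - s n)"
  shows "convergent c"
proof -
  have "Cauchy (\<lambda>n. sqrt (c n))"
  proof (rule metric_CauchyI)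
    fix e :: real assume "e > 0"
    then obtain N where "\<forall>m\<ge>N. \<forall>n\<ge>N. Dnorm \<mu> (s m - s n) < e"
      using DmuD(2)[OF s] by blast
    thus "\<exists>M. \<forall>m\<ge>M. \<forall>n\<ge>M. dist (sqrt (c m)) (sqrt (c n)) < e"
      by (auto simp: dist_real_def intro!: exI[of _ N] le_less_trans[OF le])
  qed
  then obtain L where "(\<lambda>n. sqrt (c n)) \<longlonglongrightarrow> L"
    by (auto simp: Cauchy_convergent_iff convergent_def)
  from tendsto_power[OF this, of 2] have "c \<longlonglongrightarrow> L\<^sup>2" using nn by simp
  thus ?thesis by (auto simp: convergent_def)
qed

text \<open>These limits exist, so \<open>lim\<close> in \<open>I_gpp\<close>, \<open>I_eps\<close>
  and \<open>I_gp\<close> denotes an actual limit on every Cauchy sequence.\<close>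

lemma Dmu_convergent:
  assumes s: "s \<in> Dmu \<mu>"
  shows "convergent (\<lambda>n. wint (\<mu>+1) (deriv (deriv (s n))))" "convergent (\<lambda>n. wint (\<mu>+1) (deriv (s n)))"
    "convergent (\<lambda>n. wint \<mu> (deriv (s n)))" "convergent (\<lambda>n. wint (\<mu>-1) (s n))"
proof -
  note p = DmuD(1)[OF s]
  have w: "wl2 (\<mu>+1) (deriv (deriv (s n)))" "wl2 (\<mu>+1) (deriv (s n))" "wl2 \<mu> (deriv (s n))"
    "wl2 (\<mu>-1) (s n)" for n
    using p[of n] by (auto simp: Dpre_iff)
  note t = order_trans[OF wint_triangle wint_le_Dnorm_diff(1)[OF p p]]
    order_trans[OF wint_triangle wint_le_Dnorm_diff(2)[OF p p]]
    order_trans[OF wint_triangle wint_le_Dnorm_diff(3)[OF p p]]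
    order_trans[OF wint_triangle wint_le_Dnorm_diff(4)[OF p p]]
  show "convergent (\<lambda>n. wint (\<mu>+1) (deriv (deriv (s n))))" "convergent (\<lambda>n. wint (\<mu>+1) (deriv (s n)))"
    "convergent (\<lambda>n. wint \<mu> (deriv (s n)))" "convergent (\<lambda>n. wint (\<mu>-1) (s n))"
    by (rule convergent_of_sqrt_Dnorm_Cauchy[OF s wint_nonneg], rule t; rule w)+
qed

lemma Dnorm_tendsto_0_imp_wint:
  assumes p: "\<And>n. s n \<in> Dpre \<mu>" and v: "v \<in> Dpre \<mu>"
    and l: "(\<lambda>n. Dnorm \<mu> (s n - v)) \<longlonglongrightarrow> 0"
  shows "(\<lambda>n. wint (\<mu>+1) (deriv (deriv (s n)))) \<longlonglongrightarrow> wint (\<mu>+1) (deriv (deriv v))"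
    "(\<lambda>n. wint (\<mu>+1) (deriv (s n))) \<longlonglongrightarrow> wint (\<mu>+1) (deriv v)"
    "(\<lambda>n. wint \<mu> (deriv (s n))) \<longlonglongrightarrow> wint \<mu> (deriv v)"
    "(\<lambda>n. wint (\<mu>-1) (s n)) \<longlonglongrightarrow> wint (\<mu>-1) v"
proof -
  have w: "wl2 (\<mu>+1) (deriv (deriv g))" "wl2 (\<mu>+1) (deriv g)" "wl2 \<mu> (deriv g)"
    "wl2 (\<mu>-1) g" if "g \<in> Dpre \<mu>" for g
    using that by (auto simp: Dpre_iff)
  have c: "c \<longlonglongrightarrow> d" if nn: "\<And>n. 0 \<le> c n" "0 \<le> d"
    and le: "\<And>n. \<bar>sqrt (c n) - sqrt d\<bar> \<le> Dnorm \<mu> (s n - v)" for c :: "nat \<Rightarrow> real" and d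
  proof -
    have "(\<lambda>n. sqrt (c n) - sqrt d) \<longlonglongrightarrow> 0"
      by (rule Lim_null_comparison[OF _ l]) (use le in auto)
    hence "(\<lambda>n. sqrt (c n)) \<longlonglongrightarrow> sqrt d" by (simp add: LIM_zero_iff)
    from tendsto_power[OF this, of 2] show ?thesis using nn by simp
  qed
  note t = order_trans[OF wint_triangle wint_le_Dnorm_diff(1)[OF p v]]
    order_trans[OF wint_triangle wint_le_Dnorm_diff(2)[OF p v]]
    order_trans[OF wint_triangle wint_le_Dnorm_diff(3)[OF p v]]
    order_trans[OF wint_triangle wint_le_Dnorm_diff(4)[OF p v]]
  show "(\<lambda>n. wint (\<mu>+1) (deriv (deriv (s n)))) \<longlonglongrightarrow> wint (\<mu>+1) (deriv (deriv v))"
    "(\<lambda>n. wint (\<mu>+1) (deriv (s n))) \<longlonglongrightarrow> wint (\<mu>+1) (deriv v)"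
    "(\<lambda>n. wint \<mu> (deriv (s n))) \<longlonglongrightarrow> wint \<mu> (deriv v)"
    "(\<lambda>n. wint (\<mu>-1) (s n)) \<longlonglongrightarrow> wint (\<mu>-1) v"
    by (rule c[OF wint_nonneg wint_nonneg], rule t; rule w; rule p v)+
qed

text \<open>On a compact interval, pairing \<open>z m''\<close> with the smooth function \<open>f'' x powr (\<mu>+1)\<close> and
  integrating by parts leaves only \<open>z m'\<close>, which tends to 0.\<close>
lemma Dpre_second_deriv_lsc:
  assumes z: "\<And>m. z m \<in> Dpre \<mu>" and f: "f \<in> Dpre \<mu>"
    and pt: "\<And>x. x > 0 \<Longrightarrow> (\<lambda>m. deriv (z m) x) \<longlonglongrightarrow> 0"
    and l2: "(\<lambda>m. wint \<mu> (deriv (z m))) \<longlonglongrightarrow> 0"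
    and le: "\<And>m. m \<ge> N \<Longrightarrow> wint (\<mu>+1) (\<lambda>x. deriv (deriv f) x - deriv (deriv (z m)) x) \<le> e"
  shows "wint (\<mu>+1) (deriv (deriv f)) \<le> e"
proof -
  note sf = Dpre_smooth[OF f] and sz = Dpre_smooth[OF z]
  note cf = smooth_pos_continuous_ons[OF sf] and cz = smooth_pos_continuous_ons[OF sz]
  let ?w = "\<lambda>x::real. x powr (\<mu>+1)"
  define \<phi> where "\<phi> x = deriv (deriv f) x * ?w x" for x
  define \<phi>' where "\<phi>' x = deriv (deriv (deriv f)) x * ?w x + deriv (deriv f) x * ((\<mu>+1) * x powr \<mu>)" for x
  have c\<phi>: "continuous_on {0<..} \<phi>" "continuous_on {0<..} \<phi>'"
    unfolding \<phi>_def \<phi>'_def by (auto intro!: continuous_intros cf)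
  have d\<phi>: "(\<phi> has_real_derivative \<phi>' x) (at x)" if "x > 0" for x
    unfolding \<phi>_def \<phi>'_def
    using that by (auto intro!: derivative_eq_intros smooth_pos_DERIVs[OF sf] has_real_derivative_powr)
  have I: "(LINT x:{u..v}|lborel. (deriv (deriv f) x)\<^sup>2 * ?w x) \<le> e" if u: "0 < u" "u \<le> v" for u v
  proof -
    let ?J = "\<lambda>h. LINT x:{u..v}|lborel. h x"
    have sub: "{u..v} \<subseteq> {0<..}" using u by auto
    have ci: "set_integrable lborel {u..v} h" if "continuous_on {0<..} h" for h :: "real \<Rightarrow> real"
      unfolding set_integrable_def
      by (rule borel_integrable_compact) (auto intro: continuous_on_subset[OF that sub])
    define K where "K = ?J (\<lambda>x. (\<phi>' x)\<^sup>2 * x powr (-\<mu>))"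
    \<comment> \<open>Expanding 0 \<le> (z'')^2 bounds (f'')^2 by (f'' - z'')^2 + 2 f'' z''. With
      the weight, the cross term is the derivative of z' \<phi> minus z' \<phi>', and this last
      product is split by the arithmetic-geometric inequality with parameter t.\<close>
    have b: "?J (\<lambda>x. (deriv (deriv f) x)\<^sup>2 * ?w x) \<le>
        e + 2 * (deriv (z m) v * \<phi> v - deriv (z m) u * \<phi> u) + t * wint \<mu> (deriv (z m)) + 1 / t * K"
      if m: "m \<ge> N" and t: "t > 0" for m t
    proof -
      let ?a = "\<lambda>x. (deriv (deriv f) x - deriv (deriv (z m)) x)\<^sup>2 * ?w x"
      let ?b = "\<lambda>x. deriv (deriv (z m)) x * \<phi> x + deriv (z m) x * \<phi>' x"
      let ?c = "\<lambda>x. (deriv (z m) x)\<^sup>2 * x powr \<mu>"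
      let ?d = "\<lambda>x. (\<phi>' x)\<^sup>2 * x powr (-\<mu>)"
      have i: "set_integrable lborel {u..v} ?a" "set_integrable lborel {u..v} ?b"
        "set_integrable lborel {u..v} ?c" "set_integrable lborel {u..v} ?d"
        by (rule ci; intro continuous_intros cf cz c\<phi>; simp)+
      have "?J (\<lambda>x. (deriv (deriv f) x)\<^sup>2 * ?w x) \<le> ?J (\<lambda>x. ?a x + 2 * ?b x + t * ?c x + 1 / t * ?d x)"
      proof (rule set_integral_mono)
        show "set_integrable lborel {u..v} (\<lambda>x. (deriv (deriv f) x)\<^sup>2 * ?w x)"
          by (rule ci; intro continuous_intros cf cz c\<phi>; simp)
        show "set_integrable lborel {u..v} (\<lambda>x. ?a x + 2 * ?b x + t * ?c x + 1 / t * ?d x)"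
          by (intro set_integral_add(1) set_integrable_mult_right i)
        fix x assume "x \<in> {u..v}"
        hence x: "x > 0" using u by auto
        define A where "A = deriv (z m) x * x powr (\<mu>/2)"
        define B where "B = \<phi>' x * x powr (-\<mu>/2)"
        have AB: "A * B = deriv (z m) x * \<phi>' x"
          using x by (simp add: A_def B_def powr_minus field_simps)
        have A2: "A\<^sup>2 = ?c x" and B2: "B\<^sup>2 = ?d x"
          by (simp_all add: A_def B_def power_mult_distrib power2_eq_square[of "_ powr _"] powr_add[symmetric])
        have "0 \<le> (t * A + B)\<^sup>2 / t" using t by simp
        also have "\<dots> = t * A\<^sup>2 + 2 * (A * B) + 1 / t * B\<^sup>2"
          using t by (simp add: power2_eq_square field_simps)
        finally have 1: "0 \<le> t * ?c x + 2 * (deriv (z m) x * \<phi>' x) + 1 / t * ?d x"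
          unfolding AB A2 B2 .
        have "0 \<le> (deriv (deriv (z m)) x)\<^sup>2 * ?w x" by simp
        also have "\<dots> = ?a x + 2 * (deriv (deriv (z m)) x * \<phi> x) - (deriv (deriv f) x)\<^sup>2 * ?w x"
          by (simp add: \<phi>_def power2_eq_square algebra_simps)
        finally show "(deriv (deriv f) x)\<^sup>2 * ?w x \<le> ?a x + 2 * ?b x + t * ?c x + 1 / t * ?d x"
          using 1 by (simp add: algebra_simps)
      qed
      also have "\<dots> = ?J ?a + 2 * ?J ?b + t * ?J ?c + 1 / t * K"
        unfolding K_def
        by (simp only: set_integral_add set_integrable_mult_right i set_integral_mult_right)
      also have "?J ?b = deriv (z m) v * \<phi> v - deriv (z m) u * \<phi> u"
      proof (rule set_integral_FTC(2)[OF u(2)])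
        show "continuous_on {u..v} ?b"
          by (rule continuous_on_subset[OF _ sub]) (intro continuous_intros cf cz c\<phi>)
        show "((\<lambda>x. deriv (z m) x * \<phi> x) has_real_derivative ?b x) (at x)" if "u \<le> x" for x
          using that u by (auto intro!: derivative_eq_intros smooth_pos_DERIVs[OF sz] d\<phi>)
      qed
      also have "?J ?a \<le> e"
      proof -
        have "wl2 (\<mu>+1) (\<lambda>x. deriv (deriv f) x - deriv (deriv (z m)) x)"
          using f z[of m] by (intro wl2_diff(1)) (auto simp: Dpre_iff)
        from set_int_le_pos_int(2)[of ?a u v] this u le[OF m] show ?thesis
          by (auto simp: wl2_def wint_def)
      qed
      also have "?J ?c \<le> wint \<mu> (deriv (z m))"
        unfolding wint_def by (rule set_int_le_pos_int) (use z[of m] u in \<open>auto simp: Dpre_iff wl2_def\<close>)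
      finally show ?thesis using t by simp
    qed
    \<comment> \<open>The order of the limits matters: m tends to infinity with t fixed, which
      removes everything containing z'; only then can large t remove
      \<open>1 / t * K\<close>.\<close>
    have "?J (\<lambda>x. (deriv (deriv f) x)\<^sup>2 * ?w x) \<le> e + 1 / t * K" if t: "t > 0" for t
    proof -
      have "(\<lambda>m. e + 2 * (deriv (z m) v * \<phi> v - deriv (z m) u * \<phi> u) + t * wint \<mu> (deriv (z m)) + 1 / t * K)
          \<longlonglongrightarrow> e + 2 * (0 * \<phi> v - 0 * \<phi> u) + t * 0 + 1 / t * K"
        by (intro tendsto_intros pt l2) (use u in auto)
      from LIMSEQ_le_const[OF this] b t show ?thesis by auto
    qed note bt = this
    have "((\<lambda>t::real. e + 1 / t * K) \<longlongrightarrow> e + 0 * K) at_top"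
      by (intro tendsto_intros) (rule tendsto_divide_0[OF tendsto_const], simp add: filterlim_ident filterlim_at_top_imp_at_infinity)
    from tendsto_lowerbound[OF this eventually_mono[OF eventually_gt_at_top[of 0] bt]]
    show ?thesis by simp
  qed
  have "pos_integrable (\<lambda>x. (deriv (deriv f) x)\<^sup>2 * ?w x)" using f by (auto simp: Dpre_iff wl2_def)
  note lim = pos_int_exhaust[OF this]
  have "(LINT x:{1 / real (Suc k)..real (Suc k)}|lborel. (deriv (deriv f) x)\<^sup>2 * ?w x) \<le> e" for k
    by (rule I) (simp_all add: field_simps)
  with LIMSEQ_le_const2[OF lim] show ?thesis unfolding wint_def by blast
qed

text \<open>Fatou's lemma handles the first derivatives, whose pointwise limit is given. No
  pointwise limit of the second derivatives is available, hence the separate semicontinuity lemma;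
  the integral of the squared function is dominated through Hardy's inequality.\<close>

lemma Dmu_tendsto_0:
  assumes mu: "\<mu> > 0" and z: "z \<in> Dmu \<mu>"
    and pt: "\<And>x. x > 0 \<Longrightarrow> (\<lambda>n. deriv (z n) x) \<longlonglongrightarrow> 0"
  shows "(\<lambda>n. Dnorm \<mu> (z n)) \<longlonglongrightarrow> 0"
proof -
  note p = DmuD(1)[OF z]
  have w: "wl2 (\<mu>+1) (deriv (deriv (z n)))" "wl2 (\<mu>+1) (deriv (z n))" "wl2 \<mu> (deriv (z n))"
    "wl2 (\<mu>-1) (z n)" for n
    using p[of n] by (auto simp: Dpre_iff)
  have sq: "w \<le> e\<^sup>2" if "sqrt w \<le> d" "d < e" for w d e :: real
  proof -
    have "sqrt w \<le> e" using that by simp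
    thus ?thesis by (rule sqrt_le_D)
  qed
  \<comment> \<open>Fatou is applied in m with n fixed: the difference of the derivatives of
    \<open>z n\<close> and \<open>z m\<close> tends pointwise to that of \<open>z n\<close>, which
    inherits the Cauchy bound.\<close>
  have F: "wint q (deriv (z n)) \<le> e\<^sup>2"
    if n: "n \<ge> N" and N: "\<forall>m\<ge>N. \<forall>n\<ge>N. Dnorm \<mu> (z m - z n) < e" and q: "q \<in> {\<mu>, \<mu>+1}" for q n N e
    unfolding wint_def
  proof (rule pos_int_Fatou[where N = N and f = "\<lambda>m x. (deriv (z n) x - deriv (z m) x)\<^sup>2 * x powr q"])
    have wq: "wl2 q (deriv (z n))" for n using w q by auto
    show "pos_integrable (\<lambda>x. (deriv (z n) x)\<^sup>2 * x powr q)" using wq by (auto simp: wl2_def)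
    show "pos_integrable (\<lambda>x. (deriv (z n) x - deriv (z m) x)\<^sup>2 * x powr q)" for m
      using wl2_diff(1)[OF wq[of n] wq[of m]] by (simp add: wl2_def)
    show "(\<lambda>m. (deriv (z n) x - deriv (z m) x)\<^sup>2 * x powr q) \<longlonglongrightarrow> (deriv (z n) x)\<^sup>2 * x powr q"
      if "x > 0" for x
      using pt[OF that] by (auto intro!: tendsto_eq_intros)
    show "pos_int (\<lambda>x. (deriv (z n) x - deriv (z m) x)\<^sup>2 * x powr q) \<le> e\<^sup>2" if "m \<ge> N" for m
      using sq[OF wint_le_Dnorm_diff(2)[OF p p]] sq[OF wint_le_Dnorm_diff(3)[OF p p]] N n that q
      by (auto simp: wint_def)
  qed auto
  have D0: "(\<lambda>m. wint \<mu> (deriv (z m))) \<longlonglongrightarrow> 0"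
  proof (rule LIMSEQ_I)
    fix r :: real assume r: "r > 0"
    then obtain N where N: "\<forall>m\<ge>N. \<forall>n\<ge>N. Dnorm \<mu> (z m - z n) < sqrt (r/2)"
      using DmuD(2)[OF z, of "sqrt (r/2)"] by auto
    have "norm (wint \<mu> (deriv (z n)) - 0) < r" if "n \<ge> N" for n
      using F[OF that N, of \<mu>] r wint_nonneg[of \<mu> "deriv (z n)"] by simp
    thus "\<exists>N. \<forall>n\<ge>N. norm (wint \<mu> (deriv (z n)) - 0) < r" by blast
  qed
  \<comment> \<open>The constant is 4 + 1 + 1 from the three derivative terms plus 4 / \<mu>^2 from
    Hardy's inequality.\<close>
  have b: "Dnorm2 \<mu> (z n) \<le> (6 + 4 / \<mu>\<^sup>2) * e\<^sup>2"
    if n: "n \<ge> N" and N: "\<forall>m\<ge>N. \<forall>n\<ge>N. Dnorm \<mu> (z m - z n) < e" for n N e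
  proof -
    have 1: "wint (\<mu>+1) (deriv (deriv (z n))) \<le> e\<^sup>2"
      by (rule Dpre_second_deriv_lsc[where z = z and N = N])
        (use p pt D0 N n sq[OF wint_le_Dnorm_diff(1)[OF p p]] in auto)
    have 2: "wint (\<mu>+1) (deriv (z n)) \<le> e\<^sup>2" "wint \<mu> (deriv (z n)) \<le> e\<^sup>2"
      using F[OF n N] by auto
    \<comment> \<open>The value a = \<mu>/2 minimises a (a - \<mu>), which gives Hardy's
      inequality.\<close>
    have "0 \<le> wint (\<mu>+1) (deriv (z n)) + \<mu>/2 * (\<mu>/2 - \<mu>) * wint (\<mu>-1) (z n)"
      by (rule Dpre_inequality(1)[OF mu p]) simp
    hence "\<mu>\<^sup>2 / 4 * wint (\<mu>-1) (z n) \<le> e\<^sup>2"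
      using 2 by (simp add: power2_eq_square algebra_simps)
    hence "wint (\<mu>-1) (z n) \<le> 4 / \<mu>\<^sup>2 * e\<^sup>2" using mu by (simp add: field_simps)
    thus ?thesis using 1 2 unfolding Dnorm2_eq[OF p] by (simp add: algebra_simps)
  qed
  define C where "C = sqrt (6 + 4 / \<mu>\<^sup>2)"
  have C: "C > 0" using mu by (auto simp: C_def intro!: add_pos_nonneg)
  show ?thesis
  proof (rule LIMSEQ_I)
    fix r :: real assume r: "r > 0"
    then obtain N where N: "\<forall>m\<ge>N. \<forall>n\<ge>N. Dnorm \<mu> (z m - z n) < r / (2 * C)"
      using DmuD(2)[OF z, of "r / (2 * C)"] C by auto
    have "norm (Dnorm \<mu> (z n) - 0) < r" if "n \<ge> N" for n
    proof -
      have "Dnorm \<mu> (z n) \<le> sqrt ((6 + 4 / \<mu>\<^sup>2) * (r / (2 * C))\<^sup>2)"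
        unfolding Dnorm_def by (rule real_sqrt_le_mono[OF b[OF that N]])
      also have "\<dots> = C * (r / (2 * C))"
        using r C by (simp add: real_sqrt_mult C_def)
      also have "\<dots> < r" using r C by simp
      finally show ?thesis using Dnorm2_nonneg[OF p[of n]] by (simp add: Dnorm_def)
    qed
    thus "\<exists>N. \<forall>n\<ge>N. norm (Dnorm \<mu> (z n) - 0) < r" by blast
  qed
qed

section \<open>Kummer functions\<close>

lemma pochhammer_ratio_bounds:
  fixes b c :: real
  assumes "0 < b" "b \<le> c"
  shows "0 < pochhammer b k / pochhammer c k" "pochhammer b k / pochhammer c k \<le> 1"
proof -
  have p: "0 < pochhammer b k" "0 < pochhammer c k" using assms by (auto intro!: pochhammer_pos)
  show "0 < pochhammer b k / pochhammer c k" using p by simp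
  have "pochhammer b k \<le> pochhammer c k"
    unfolding pochhammer_prod using assms by (intro prod_mono) auto
  thus "pochhammer b k / pochhammer c k \<le> 1" using p by simp
qed

lemma exp_suminf: "(\<lambda>k. x ^ k / fact k) sums exp (x::real)"
  using exp_converges[of x] by (simp add: divide_inverse mult.commute)

lemma summable_hyp1F1:
  fixes b c x :: real
  assumes "0 < b" "b \<le> c"
  shows "summable (\<lambda>k. pochhammer b k / pochhammer c k * x ^ k / fact k)"
proof (rule summable_comparison_test')
  show "summable (\<lambda>k. \<bar>x\<bar> ^ k / fact k)" using exp_suminf by (auto simp: sums_iff)
  fix k
  have "pochhammer b k / pochhammer c k * (\<bar>x\<bar> ^ k / fact k) \<le> 1 * (\<bar>x\<bar> ^ k / fact k)"
    using pochhammer_ratio_bounds[OF assms, of k] by (intro mult_right_mono) auto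
  thus "norm (pochhammer b k / pochhammer c k * x ^ k / fact k) \<le> \<bar>x\<bar> ^ k / fact k"
    using pochhammer_pos[of b k] pochhammer_pos[of c k] assms by (simp add: abs_mult power_abs)
qed

lemma hyp1F1_bounds:
  assumes "0 < b" "b \<le> c" "x \<ge> 0"
  shows "1 \<le> hyp1F1 b c x" "hyp1F1 b c x \<le> exp x"
proof -
  let ?t = "\<lambda>k. pochhammer b k / pochhammer c k * x ^ k / fact k"
  note r = pochhammer_ratio_bounds[OF assms(1,2)]
  note s = summable_hyp1F1[OF assms(1,2), of x]
  have nn: "0 \<le> ?t k" for k
    using mult_nonneg_nonneg[OF less_imp_le[OF r(1)[of k]], of "x ^ k / fact k"] assms(3) by simp
  have "sum ?t {0} \<le> suminf ?t" by (rule sum_le_suminf[OF s]) (use nn in auto)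
  thus "1 \<le> hyp1F1 b c x" by (simp add: hyp1F1_def)
  have le: "?t k \<le> x ^ k / fact k" for k
    using mult_right_mono[OF r(2)[of k], of "x ^ k / fact k"] assms(3) by simp
  have "suminf ?t \<le> (\<Sum>k. x ^ k / fact k)"
    by (rule suminf_le[OF le s]) (use exp_suminf[of x] in \<open>simp add: sums_iff\<close>)
  also have "\<dots> = exp x" using exp_suminf[of x] by (simp add: sums_iff)
  finally show "hyp1F1 b c x \<le> exp x" by (simp add: hyp1F1_def)
qed

lemma hyp1F1_DERIV:
  assumes "0 < b" "b \<le> c"
  shows "(hyp1F1 b c has_real_derivative b / c * hyp1F1 (b+1) (c+1) x) (at x)"
proof -
  let ?c = "\<lambda>k. pochhammer b k / pochhammer c k / fact k"
  have s: "summable (\<lambda>k. ?c k * y ^ k)" for y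
    using summable_hyp1F1[OF assms, of y] by (simp add: field_simps)
  have d: "diffs ?c k * x ^ k =
      b / c * (pochhammer (b+1) k / pochhammer (c+1) k * x ^ k / fact k)" for k
    using assms by (simp add: diffs_def pochhammer_rec field_simps del: of_nat_Suc)
  have "((\<lambda>x. \<Sum>k. ?c k * x ^ k) has_real_derivative (\<Sum>k. diffs ?c k * x ^ k)) (at x)"
    by (rule termdiffs_strong_converges_everywhere[OF s])
  also have "(\<Sum>k. diffs ?c k * x ^ k) = b / c * hyp1F1 (b+1) (c+1) x"
    unfolding d hyp1F1_def using assms by (intro suminf_mult summable_hyp1F1) auto
  also have "(\<lambda>x. \<Sum>k. ?c k * x ^ k) = hyp1F1 b c"
    by (simp add: hyp1F1_def fun_eq_iff)
  finally show ?thesis .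
qed

text \<open>The left side is 1F1 minus its derivative, compared coefficientwise. The result keeps
  the first parameter and raises the second, which is why differentiating exp(-x) 1F1 stays within
  one family.\<close>

lemma hyp1F1_contiguous:
  assumes "0 < b" "b \<le> c"
  shows "hyp1F1 b c x - b / c * hyp1F1 (b+1) (c+1) x = (c - b) / c * hyp1F1 b (c+1) x"
proof -
  have c: "c > 0" using assms by simp
  note s = summable_hyp1F1[OF assms, of x]
  have s1: "summable (\<lambda>k. pochhammer (b+1) k / pochhammer (c+1) k * x ^ k / fact k)"
    "summable (\<lambda>k. pochhammer b k / pochhammer (c+1) k * x ^ k / fact k)"
    by (rule summable_hyp1F1; use assms in simp)+
  have e: "pochhammer b k / pochhammer c k * x ^ k / fact k
      - b / c * (pochhammer (b+1) k / pochhammer (c+1) k * x ^ k / fact k)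
      = (c - b) / c * (pochhammer b k / pochhammer (c+1) k * x ^ k / fact k)" for k
  proof -
    \<comment> \<open>A Pochhammer symbol of length k + 1 can be split at its first or at its last
      factor.\<close>
    have 1: "b * pochhammer (b+1) k = (b + k) * pochhammer b k"
      "c * pochhammer (c+1) k = (c + k) * pochhammer c k"
      by (simp_all add: pochhammer_rec[symmetric] pochhammer_rec')
    have p: "pochhammer c k > 0" "pochhammer (c+1) k > 0" using c by (auto intro!: pochhammer_pos)
    have "pochhammer b k / pochhammer c k = (c + k) * pochhammer b k / (c * pochhammer (c+1) k)"
      unfolding 1 using c by (simp add: add_pos_nonneg)
    moreover have "b / c * (pochhammer (b+1) k / pochhammer (c+1) k) =
        (b + k) * pochhammer b k / (c * pochhammer (c+1) k)"
      by (simp add: 1(1)[symmetric])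
    ultimately have "pochhammer b k / pochhammer c k - b / c * (pochhammer (b+1) k / pochhammer (c+1) k)
        = (c - b) / c * (pochhammer b k / pochhammer (c+1) k)"
      using c p by (simp add: field_simps)
    moreover have "R1 * y / f - p * (R2 * y / f) = q * (R3 * y / f)"
      if "R1 - p * R2 = q * R3" for R1 R2 R3 p q y f :: real
    proof -
      have "R1 * y / f - p * (R2 * y / f) = (R1 - p * R2) * (y / f)"
        by (simp add: left_diff_distrib diff_divide_distrib)
      also have "\<dots> = q * (R3 * y / f)" unfolding that by simp
      finally show ?thesis .
    qed
    ultimately show ?thesis by blast
  qed
  have "hyp1F1 b c x - b / c * hyp1F1 (b+1) (c+1) x =
      (\<Sum>k. pochhammer b k / pochhammer c k * x ^ k / fact k
      - b / c * (pochhammer (b+1) k / pochhammer (c+1) k * x ^ k / fact k))"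
    unfolding hyp1F1_def suminf_mult[OF s1(1), symmetric] by (intro suminf_diff s summable_mult s1)
  also have "\<dots> = (c - b) / c * hyp1F1 b (c+1) x"
    unfolding e hyp1F1_def by (rule suminf_mult[OF s1(2)])
  finally show ?thesis .
qed

text \<open>A three-term relation in the second parameter, which becomes the differential equation
  once the derivatives of \<open>kummer\<close> are known. The constant terms on the left cancel, so
  the series starts at index 1, and this produces the factor x.\<close>

lemma hyp1F1_contiguous_shift:
  assumes "0 < b" "b \<le> c"
  shows "hyp1F1 b c x - hyp1F1 b (c+1) x =
    x * (hyp1F1 b (c+1) x / c) - x * ((c + 1 - b) / (c * (c+1)) * hyp1F1 b (c+2) x)"
proof -
  have c: "c > 0" using assms by simp
  let ?t = "\<lambda>c k. pochhammer b k / pochhammer c k * x ^ k / fact k"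
  have s: "summable (?t c)" "summable (?t (c+1))" "summable (?t (c+2))"
    by (rule summable_hyp1F1; use assms in simp)+
  have e: "?t c (Suc n) - ?t (c+1) (Suc n) =
      x / c * ?t (c+1) n - x * ((c + 1 - b) / (c * (c+1))) * ?t (c+2) n" for n
  proof -
    define P where "P = pochhammer (c+2) n"
    have P: "P > 0" unfolding P_def using c by (auto intro!: pochhammer_pos)
    have q1: "pochhammer (c+1) (Suc n) = (c+1) * P"
      by (simp add: pochhammer_rec P_def add.assoc)
    hence q2: "pochhammer (c+1) n = (c+1) * P / (c + 1 + n)"
      using c by (simp add: pochhammer_rec' field_simps)
    have q3: "pochhammer c (Suc n) = c * ((c+1) * P / (c + 1 + n))"
      by (simp add: pochhammer_rec[of c] q2)
    have q4: "pochhammer b (Suc n) = (b + n) * pochhammer b n" by (simp add: pochhammer_rec')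
    have f: "fact (Suc n) = (1 + real n) * fact n" by simp
    have pos: "c + 1 + real n > 0" "1 + real n > 0" "c + 1 > 0" using c by auto
    define B where "B = pochhammer b n * x ^ n / fact n"
    have l: "?t c (Suc n) - ?t (c+1) (Suc n) =
        x * B * (b + n) / (1 + real n) * ((c + 1 + n) / (c * (c+1) * P) - 1 / ((c+1) * P))"
      unfolding q1 q3 q4 f B_def by (simp add: divide_simps) (simp add: algebra_simps)?
    have r: "x / c * ?t (c+1) n - x * ((c + 1 - b) / (c * (c+1))) * ?t (c+2) n =
        x * B * ((c + 1 + n) / (c * (c+1) * P) - (c + 1 - b) / (c * (c+1) * P))"
      unfolding q2 P_def[symmetric] B_def by (simp add: divide_simps) (simp add: algebra_simps)?
    show ?thesis unfolding l r using c P pos by (simp add: divide_simps) (simp add: algebra_simps)?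
  qed
  have "hyp1F1 b c x - hyp1F1 b (c+1) x = (\<Sum>k. ?t c k - ?t (c+1) k)"
    unfolding hyp1F1_def by (rule suminf_diff[OF s(1,2)])
  also have "\<dots> = (\<Sum>n. ?t c (Suc n) - ?t (c+1) (Suc n))"
    by (subst suminf_split_head[OF summable_diff[OF s(1,2)]]) simp
  also have "\<dots> = (\<Sum>n. x / c * ?t (c+1) n - x * ((c + 1 - b) / (c * (c+1))) * ?t (c+2) n)"
    by (simp only: e)
  also have "\<dots> = x / c * hyp1F1 b (c+1) x - x * ((c + 1 - b) / (c * (c+1))) * hyp1F1 b (c+2) x"
    unfolding hyp1F1_def suminf_mult[OF s(2), symmetric] suminf_mult[OF s(3), symmetric]
    by (rule suminf_diff[symmetric]) (intro summable_mult s)+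
  finally show ?thesis by simp
qed

text \<open>By Kummer's transformation this is 1F1(a, a + b, -x). With a and b as parameters,
  instead of b and the sum, differentiation shifts a alone.\<close>

definition kummer :: "real \<Rightarrow> real \<Rightarrow> real \<Rightarrow> real" where
  "kummer a b x = exp (- x) * hyp1F1 b (a + b) x"

lemma kummer_DERIV:
  assumes "0 < a" "0 < b"
  shows "(kummer a b has_real_derivative - (a / (a + b)) * kummer (a+1) b x) (at x)"
proof -
  have h: "(hyp1F1 b (a+b) has_real_derivative b / (a+b) * hyp1F1 (b+1) (a+b+1) x) (at x)"
    by (rule hyp1F1_DERIV) (use assms in auto)
  have e: "hyp1F1 b (a+b) x - b / (a+b) * hyp1F1 (b+1) (a+b+1) x = a / (a+b) * hyp1F1 b (a+b+1) x"
    using hyp1F1_contiguous[of b "a+b" x] assms by simp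
  have "(kummer a b has_real_derivative
      exp (-x) * (b / (a+b) * hyp1F1 (b+1) (a+b+1) x) - exp (-x) * hyp1F1 b (a+b) x) (at x)"
    unfolding kummer_def by (auto intro!: derivative_eq_intros h)
  also have "exp (-x) * (b / (a+b) * hyp1F1 (b+1) (a+b+1) x) - exp (-x) * hyp1F1 b (a+b) x =
      - (exp (-x) * (hyp1F1 b (a+b) x - b / (a+b) * hyp1F1 (b+1) (a+b+1) x))"
    by (simp add: algebra_simps)
  also have "\<dots> = - (a / (a + b)) * kummer (a+1) b x"
    unfolding e by (simp add: kummer_def add_ac)
  finally show ?thesis .
qed

lemma kummer_scaled_DERIV:
  assumes "0 < a" "0 < b"
  shows "((\<lambda>x. kummer a b (l * x)) has_real_derivative - (a / (a + b)) * kummer (a+1) b (l * x) * l) (at x)"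
proof -
  have "((\<lambda>x. l * x) has_real_derivative l) (at x)" by (auto intro!: derivative_eq_intros)
  from DERIV_chain2[OF kummer_DERIV[OF assms] this] show ?thesis .
qed

lemma kummer_bounds:
  assumes "0 < a" "0 < b" "x \<ge> 0"
  shows "exp (-x) \<le> kummer a b x" "kummer a b x \<le> 1" "0 < kummer a b x"
proof -
  have h: "1 \<le> hyp1F1 b (a+b) x" "hyp1F1 b (a+b) x \<le> exp x"
    using hyp1F1_bounds[of b "a+b" x] assms by auto
  show 1: "exp (-x) \<le> kummer a b x"
    unfolding kummer_def using mult_left_mono[OF h(1), of "exp (-x)"] by simp
  show "kummer a b x \<le> 1"
    unfolding kummer_def using mult_left_mono[OF h(2), of "exp (-x)"] by (simp add: exp_minus)
  show "0 < kummer a b x" using less_le_trans[OF exp_gt_zero 1] .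
qed

text \<open>The coefficients of \<open>kummer (a+2) b x\<close> and \<open>kummer (a+1) b x\<close>
  are those in the second derivative and in minus the first derivative of u =
  \<open>kummer a b\<close>. This is thus x u'' + (a + b + x) u' + a u = 0, the three-term relation
  multiplied by a exp(-x).\<close>

lemma kummer_ODE:
  assumes "0 < a" "0 < b"
  shows "x * (a * (a+1) / ((a+b) * (a+b+1)) * kummer (a+2) b x)
    - (a + b + x) * (a / (a+b) * kummer (a+1) b x) + a * kummer a b x = 0"
proof -
  define c where "c = a + b"
  have c: "c > 0" using assms by (simp add: c_def)
  have "hyp1F1 b c x = hyp1F1 b (c+1) x + x * (hyp1F1 b (c+1) x / c)
      - x * ((a + 1) / (c * (c+1)) * hyp1F1 b (c+2) x)"
    using hyp1F1_contiguous_shift[of b c x] assms by (simp add: c_def)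
  hence "x * (a * (a+1) / (c * (c+1)) * hyp1F1 b (c+2) x)
      - (c + x) * (a / c * hyp1F1 b (c+1) x) + a * hyp1F1 b c x = 0"
    using c by (simp only:) (simp add: field_simps)
  hence "exp (-x) * (x * (a * (a+1) / (c * (c+1)) * hyp1F1 b (c+2) x)
      - (c + x) * (a / c * hyp1F1 b (c+1) x) + a * hyp1F1 b c x) = 0" by simp
  thus ?thesis unfolding kummer_def c_def by (simp add: algebra_simps)
qed

section \<open>Decay at infinity\<close>

text \<open>The ratio behaves like Gamma(a+b) / Gamma(b) times k powr (-a), by the limit formula for
  the Gamma function, and a convergent sequence is bounded.\<close>

lemma pochhammer_ratio_decay:
  fixes a b :: real
  assumes "0 < a" "0 < b"
  obtains C where "C > 0" "\<And>k. pochhammer b k / pochhammer (a + b) k * (real k + 1) powr a \<le> C"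
proof -
  have nn: "b \<notin> \<int>\<^sub>\<le>\<^sub>0" "a + b \<notin> \<int>\<^sub>\<le>\<^sub>0" using assms by (auto elim!: nonpos_Ints_cases)
  have "(\<lambda>n. Gamma_series' (a+b) n / Gamma_series' b n) \<longlonglongrightarrow> Gamma (a+b) / Gamma b"
    by (intro tendsto_intros Gamma_series'_LIMSEQ) (use nn in \<open>auto simp: Gamma_eq_zero_iff\<close>)
  from convergent_imp_Bseq[OF convergentI[OF this]]
  obtain C1 where C1: "C1 > 0" "\<And>n. norm (Gamma_series' (a+b) n / Gamma_series' b n) \<le> C1"
    by (auto elim: BseqE)
  have e: "Gamma_series' (a+b) n / Gamma_series' b n = pochhammer b n / pochhammer (a+b) n * real n powr a"
    if "n > 0" for n
  proof -
    have "pochhammer b n > 0" "pochhammer (a+b) n > 0" using assms by (auto intro!: pochhammer_pos)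
    thus ?thesis using that
      by (simp add: Gamma_series'_def powr_def field_simps exp_add[symmetric])
  qed
  \<comment> \<open>The summand 1 covers k = 0, where the left side is 1; for k \<ge> 1 the factor 2
    powr a comes from k + 1 \<le> 2 k.\<close>
  have "pochhammer b k / pochhammer (a + b) k * (real k + 1) powr a \<le> 1 + 2 powr a * C1" for k
  proof (cases "k = 0")
    case True thus ?thesis using C1(1) by simp
  next
    case False
    have r: "0 < pochhammer b k / pochhammer (a + b) k"
      by (rule pochhammer_ratio_bounds) (use assms in auto)
    have "(real k + 1) powr a \<le> (2 * real k) powr a" using False assms by (intro powr_mono2) auto
    hence "pochhammer b k / pochhammer (a + b) k * (real k + 1) powr a \<le>
        pochhammer b k / pochhammer (a + b) k * (2 * real k) powr a"
      using r by (intro mult_left_mono) auto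
    also have "\<dots> = 2 powr a * (Gamma_series' (a+b) k / Gamma_series' b k)"
      using False by (simp add: e powr_mult)
    also have "\<dots> \<le> 2 powr a * C1"
      by (intro mult_left_mono order_trans[OF abs_ge_self C1(2)[unfolded real_norm_def]]) simp
    finally show ?thesis by simp
  qed
  thus ?thesis using C1(1) by (intro that[of "1 + 2 powr a * C1"]) (auto intro: add_pos_pos)
qed

text \<open>It turns a polynomial weight into an index shift: (x / (k+1))^m x^k / k! is at most m!
  x^(k+m) / (k+m)!, a term of the tail of the exponential series.\<close>

lemma fact_add_le: "fact (k + m) \<le> fact k * fact m * (real k + 1) ^ m"
proof (induction m)
  case (Suc m)
  have "fact (k + Suc m) = (real (k + m) + 1) * fact (k + m)" by (simp add: algebra_simps)
  also have "\<dots> \<le> ((real m + 1) * (real k + 1)) * (fact k * fact m * (real k + 1) ^ m)"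
    by (intro mult_mono Suc.IH) (auto simp: algebra_simps)
  finally show ?case by (simp add: algebra_simps)
qed simp

text \<open>The interpolation \<open>y powr a \<le> 1 + y ^ m\<close> for \<open>y = x / (k + 1)\<close> reduces the bound to the exponential series.\<close>
lemma kummer_decay:
  assumes "0 < a" "0 < b"
  obtains C where "\<And>x. x > 0 \<Longrightarrow> kummer a b x \<le> C * x powr (-a)"
proof -
  obtain C where C: "C > 0" "\<And>k. pochhammer b k / pochhammer (a + b) k * (real k + 1) powr a \<le> C"
    using pochhammer_ratio_decay[OF assms] by blast
  define m where "m = nat \<lceil>a\<rceil>"
  have m: "a \<le> real m" using assms by (simp add: m_def)
  have i: "y powr a \<le> 1 + y ^ m" if "y > 0" for y :: real
  proof (cases "y \<le> 1")
    case True
    hence "y powr a \<le> 1" using that assms powr_le1[of a y] by simp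
    thus ?thesis using that by (simp add: add_increasing2)
  next
    case False
    hence "y powr a \<le> y powr real m" using m by (intro powr_mono) auto
    thus ?thesis using that by (simp add: powr_realpow)
  qed
  have main: "x powr a * hyp1F1 b (a+b) x \<le> C * (1 + fact m) * exp x" if x: "x > 0" for x
  proof -
    let ?t = "\<lambda>k. pochhammer b k / pochhammer (a+b) k * x ^ k / fact k"
    let ?u = "\<lambda>k. x ^ k / fact k :: real" and ?v = "\<lambda>k. x ^ (k + m) / fact (k + m) :: real"
    have s: "summable ?t" by (rule summable_hyp1F1) (use assms in auto)
    have su: "summable ?u" "suminf ?u = exp x" using exp_suminf[of x] by (auto simp: sums_iff)
    have sv: "summable ?v" using summable_ignore_initial_segment[OF su(1), of m] .
    have "suminf ?v + sum ?u {..<m} = exp x"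
      using suminf_split_initial_segment[OF su(1), of m] su(2) by simp
    moreover have "0 \<le> sum ?u {..<m}" using x by (intro sum_nonneg) auto
    ultimately have v: "suminf ?v \<le> exp x" by linarith
    have le: "x powr a * ?t k \<le> C * ?u k + C * fact m * ?v k" for k
    proof -
      let ?q = "real k + 1"
      have q: "?q > 0" by simp
      \<comment> \<open>One factor compensates the decay of the Pochhammer ratio; the other is left
        for the interpolation.\<close>
      have "x powr a = (x / ?q) powr a * ?q powr a"
        using x by (simp add: powr_divide)
      hence "x powr a * ?t k = (pochhammer b k / pochhammer (a+b) k * ?q powr a) * ((x / ?q) powr a * ?u k)"
        by simp
      also have "\<dots> \<le> C * ((x / ?q) powr a * ?u k)"
        by (rule mult_right_mono[OF C(2)]) (use x in auto)
      also have "\<dots> \<le> C * ((1 + (x / ?q) ^ m) * ?u k)"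
        using C(1) x by (intro mult_left_mono mult_right_mono i) auto
      also have "(x / ?q) ^ m * ?u k \<le> fact m * ?v k"
      proof -
        have "x ^ (k + m) * fact (k + m) \<le> x ^ (k + m) * (fact k * fact m * ?q ^ m)"
          using x by (intro mult_left_mono fact_add_le) auto
        hence "x ^ (k + m) / (?q ^ m * fact k) \<le> x ^ (k + m) * fact m / fact (k + m)"
          using q by (simp add: divide_le_eq le_divide_eq pos_divide_le_eq pos_le_divide_eq mult_ac)
        thus ?thesis by (simp add: power_divide power_add mult_ac)
      qed
      hence "C * ((1 + (x / ?q) ^ m) * ?u k) \<le> C * (?u k + fact m * ?v k)"
        using C(1) by (intro mult_left_mono) (auto simp: algebra_simps)
      finally show ?thesis by (simp add: algebra_simps)
    qed
    have "x powr a * suminf ?t = (\<Sum>k. x powr a * ?t k)" by (rule suminf_mult[OF s, symmetric])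
    also have "\<dots> \<le> (\<Sum>k. C * ?u k + C * fact m * ?v k)"
      by (rule suminf_le[OF le]) (intro summable_mult summable_add s su sv)+
    also have "(\<lambda>k. C * ?u k + C * fact m * ?v k) sums (C * suminf ?u + C * fact m * suminf ?v)"
      by (intro sums_add sums_mult summable_sums su(1) sv)
    hence "(\<Sum>k. C * ?u k + C * fact m * ?v k) = C * suminf ?u + C * fact m * suminf ?v"
      by (rule sums_unique[symmetric])
    also have "\<dots> \<le> C * exp x + C * fact m * exp x"
      unfolding su(2) using C(1) v by (intro add_left_mono mult_left_mono) auto
    finally show ?thesis by (simp add: hyp1F1_def algebra_simps)
  qed
  have "kummer a b x \<le> C * (1 + fact m) * x powr (-a)" if x: "x > 0" for x
  proof -
    have "x powr a * kummer a b x = exp (-x) * (x powr a * hyp1F1 b (a+b) x)"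
      by (simp add: kummer_def)
    also have "\<dots> \<le> exp (-x) * (C * (1 + fact m) * exp x)"
      by (rule mult_left_mono[OF main[OF x]]) simp
    also have "\<dots> = C * (1 + fact m)" by (simp add: exp_minus)
    finally show ?thesis using x by (simp add: powr_minus field_simps)
  qed
  thus ?thesis by (rule that)
qed

section \<open>Membership of the Kummer functions in the function space\<close>

lemma pos_integrable_powr_bounds:
  assumes c: "continuous_on {0<..} f" and p: "p > -1" "q < -1"
    and le: "\<And>x. x > 0 \<Longrightarrow> \<bar>f x\<bar> \<le> C * x powr p" "\<And>x. x > 0 \<Longrightarrow> \<bar>f x\<bar> \<le> D * x powr q"
  shows "pos_integrable f"
proof -
  have m: "set_borel_measurable lborel S f" if "S \<in> sets borel" "S \<subseteq> {0<..}" for S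
    unfolding set_borel_measurable_def
    using borel_measurable_continuous_on_indicator[OF that(1) continuous_on_subset[OF c that(2)]] by simp
  have lb: "set_integrable lborel S (\<lambda>x. x powr r)"
    if "(\<lambda>x. x powr r) integrable_on S" "S \<in> sets borel" "S \<subseteq> {0<..}" for S and r :: real
  proof -
    have "(\<lambda>x. x powr r) absolutely_integrable_on S"
      using that by (subst absolutely_integrable_on_iff_nonneg) auto
    moreover have "(\<lambda>x. indicator S x *\<^sub>R x powr r) \<in> borel_measurable lborel"
    proof -
      have "continuous_on S (\<lambda>x. x powr r)" using that(3) by (intro continuous_intros) auto
      from borel_measurable_continuous_on_indicator[OF that(2) this] show ?thesis by simp
    qed
    ultimately show ?thesis unfolding set_integrable_def
      by (subst (asm) integrable_completion) auto
  qed
  have "set_integrable lborel {0<..1} (\<lambda>x. C * x powr p)"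
    by (intro set_integrable_mult_right lb integrable_on_powr_from_0') (use p in auto)
  hence 1: "set_integrable lborel {0<..1} f"
    by (rule set_integrable_bound[OF _ m]) (use le(1) in \<open>auto intro!: AE_I2 order_trans[OF _ abs_ge_self]\<close>)
  have "(\<lambda>x. x powr q) integrable_on {1..}"
    using has_integral_powr_to_inf[OF p(2), of 1] by auto
  hence "set_integrable lborel {1..} (\<lambda>x. D * x powr q)"
    by (intro set_integrable_mult_right lb) auto
  hence 2: "set_integrable lborel {1..} f"
    by (rule set_integrable_bound[OF _ m]) (use le(2) in \<open>auto intro!: AE_I2 order_trans[OF _ abs_ge_self]\<close>)
  have "{0<..1} \<union> {1..} = {0::real<..}" by auto
  with set_integrable_Un[OF 1 2] show ?thesis by simp
qed

lemma wl2_powr_bounds: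
  assumes c: "continuous_on {0<..} \<phi>" and p: "p > -1" "p - 2 * d < -1"
    and le: "\<And>x. x > 0 \<Longrightarrow> \<bar>\<phi> x\<bar> \<le> M" "\<And>x. x > 0 \<Longrightarrow> \<bar>\<phi> x\<bar> \<le> D * x powr (-d)"
  shows "wl2 p \<phi>"
proof -
  have "pos_integrable (\<lambda>x. (\<phi> x)\<^sup>2 * x powr p)"
  proof (rule pos_integrable_powr_bounds[OF _ p])
    show "continuous_on {0<..} (\<lambda>x. (\<phi> x)\<^sup>2 * x powr p)" using c by (auto intro!: continuous_intros)
    fix x :: real assume x: "x > 0"
    have "\<bar>\<phi> x\<bar>\<^sup>2 \<le> M\<^sup>2" by (rule power_mono[OF le(1)[OF x]]) simp
    thus "\<bar>(\<phi> x)\<^sup>2 * x powr p\<bar> \<le> M\<^sup>2 * x powr p" by (simp add: abs_mult mult_right_mono)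
    have "\<bar>\<phi> x\<bar>\<^sup>2 \<le> (D * x powr (-d))\<^sup>2" by (rule power_mono[OF le(2)[OF x]]) simp
    hence "(\<phi> x)\<^sup>2 * x powr p \<le> (D * x powr (-d))\<^sup>2 * x powr p" by (simp add: mult_right_mono)
    also have "\<dots> = D\<^sup>2 * (x powr (-d) * x powr (-d) * x powr p)" by (simp add: power2_eq_square mult_ac)
    also have "x powr (-d) * x powr (-d) * x powr p = x powr (p - 2 * d)"
      by (simp add: powr_add[symmetric])
    finally show "\<bar>(\<phi> x)\<^sup>2 * x powr p\<bar> \<le> D\<^sup>2 * x powr (p - 2 * d)" by simp
  qed
  thus ?thesis using c by (simp add: wl2_def)
qed

lemma kummer_funpow_deriv:
  assumes "0 < a" "0 < b"
  shows "(deriv ^^ k) (\<lambda>x. C * kummer a b (l * x)) =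
    (\<lambda>x. C * (-l) ^ k * (pochhammer a k / pochhammer (a+b) k) * kummer (a + k) b (l * x))"
proof (induction k)
  case (Suc k)
  have "deriv (\<lambda>x. C * (-l) ^ k * (pochhammer a k / pochhammer (a+b) k) * kummer (a + k) b (l * x)) x =
      C * (-l) ^ Suc k * (pochhammer a (Suc k) / pochhammer (a+b) (Suc k)) * kummer (a + Suc k) b (l * x)" for x
  proof (rule DERIV_imp_deriv)
    have "((\<lambda>x. kummer (a + real k) b (l * x)) has_real_derivative
        - ((a + k) / (a + k + b)) * kummer (a + k + 1) b (l * x) * l) (at x)"
      by (rule kummer_scaled_DERIV) (use assms in auto)
    from DERIV_cmult[OF this, of "C * (-l) ^ k * (pochhammer a k / pochhammer (a+b) k)"]
    show "((\<lambda>x. C * (-l) ^ k * (pochhammer a k / pochhammer (a+b) k) * kummer (a + k) b (l * x))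
      has_real_derivative C * (-l) ^ Suc k * (pochhammer a (Suc k) / pochhammer (a+b) (Suc k))
        * kummer (a + Suc k) b (l * x)) (at x)"
      by (simp add: pochhammer_rec' add_ac mult_ac)
  qed
  thus ?case by (simp only: funpow.simps o_apply Suc fun_eq_iff) simp
qed simp

lemma kummer_derivs:
  assumes "0 < a" "0 < b"
  shows "deriv (\<lambda>x. C * kummer a b (l * x)) = (\<lambda>x. - (C * l * (a / (a+b))) * kummer (a+1) b (l * x))"
    "deriv (deriv (\<lambda>x. C * kummer a b (l * x))) =
      (\<lambda>x. C * l\<^sup>2 * (a * (a+1) / ((a+b) * (a+b+1))) * kummer (a+2) b (l * x))"
  using kummer_funpow_deriv[OF assms, where C = C and l = l, of 1]
    kummer_funpow_deriv[OF assms, where C = C and l = l, of 2]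
  by (simp_all add: numeral_2_eq_2 pochhammer_rec power2_eq_square add_ac)

lemma kummer_smooth_pos:
  assumes "0 < a" "0 < b"
  shows "smooth_pos (\<lambda>x. C * kummer a b (l * x))"
  unfolding smooth_pos_def
proof (intro allI impI)
  fix k :: nat and x :: real
  have "((\<lambda>x. kummer (a + real k) b (l * x)) has_real_derivative
        - ((a + k) / (a + k + b)) * kummer (a + k + 1) b (l * x) * l) (at x)"
    by (rule kummer_scaled_DERIV) (use assms in auto)
  from DERIV_cmult[OF this, of "C * (-l) ^ k * (pochhammer a k / pochhammer (a+b) k)"]
  show "(deriv ^^ k) (\<lambda>x. C * kummer a b (l * x)) differentiable at x"
    unfolding kummer_funpow_deriv[OF assms] by (auto simp: real_differentiable_def)
qed

lemma kummer_scaled_bounds: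
  assumes "0 < a" "0 < b" "l > 0"
  obtains D where "\<And>x. x > 0 \<Longrightarrow> \<bar>c * kummer a b (l * x)\<bar> \<le> \<bar>c\<bar>"
    "\<And>x. x > 0 \<Longrightarrow> \<bar>c * kummer a b (l * x)\<bar> \<le> D * x powr (-a)"
proof -
  obtain C where C: "\<And>x. x > 0 \<Longrightarrow> kummer a b x \<le> C * x powr (-a)"
    using kummer_decay[OF assms(1,2)] by blast
  have k: "0 < kummer a b (l * x)" "kummer a b (l * x) \<le> 1" if "x > 0" for x
    using kummer_bounds[OF assms(1,2), of "l * x"] that assms(3) by auto
  have "\<bar>c * kummer a b (l * x)\<bar> \<le> \<bar>c\<bar>" if "x > 0" for x
    using k[OF that] by (simp add: abs_mult mult_left_le)
  moreover have "\<bar>c * kummer a b (l * x)\<bar> \<le> \<bar>c\<bar> * C * l powr (-a) * x powr (-a)" if x: "x > 0" for x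
  proof -
    have "\<bar>c * kummer a b (l * x)\<bar> = \<bar>c\<bar> * kummer a b (l * x)"
      using k[OF x] by (simp add: abs_mult)
    also have "\<dots> \<le> \<bar>c\<bar> * (C * (l * x) powr (-a))"
      by (rule mult_left_mono[OF C]) (use x assms(3) in auto)
    finally show ?thesis using x assms(3) by (simp add: powr_mult mult_ac)
  qed
  ultimately show ?thesis by (rule that)
qed

text \<open>At infinity g^2 x powr (\<mu>-1) and (g')^2 x powr (\<mu>+1) are bounded by multiples of
  x powr (b - a - 1), so \<open>b < a\<close> makes them integrable; near 0 boundedness of g and its
  derivatives suffices. The same inequality makes the boundary terms, of order x powr (b - a),
  vanish.\<close>

lemma kummer_in_Dpre:
  assumes ab: "0 < a" "0 < b" and ba: "b < a" and l: "l > 0"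
  shows "(\<lambda>x. C * kummer a b (l * x)) \<in> Dpre (a + b)"
proof -
  let ?g = "\<lambda>x. C * kummer a b (l * x)" and ?\<mu> = "a + b"
  note d = kummer_derivs[OF ab, where C = C and l = l]
  have a: "0 < a + 1" "0 < a + 2" using ab by auto
  obtain D0 where D0: "\<And>x. x > 0 \<Longrightarrow> \<bar>?g x\<bar> \<le> \<bar>C\<bar>" "\<And>x. x > 0 \<Longrightarrow> \<bar>?g x\<bar> \<le> D0 * x powr (-a)"
    using kummer_scaled_bounds[OF ab l, of C] by blast
  obtain D1 where D1: "\<And>x. x > 0 \<Longrightarrow> \<bar>deriv ?g x\<bar> \<le> \<bar>- (C * l * (a / (a+b)))\<bar>"
    "\<And>x. x > 0 \<Longrightarrow> \<bar>deriv ?g x\<bar> \<le> D1 * x powr (-(a+1))"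
    unfolding d(1) using kummer_scaled_bounds[OF a(1) ab(2) l, of "- (C * l * (a / (a+b)))"] by blast
  obtain D2 where D2: "\<And>x. x > 0 \<Longrightarrow> \<bar>deriv (deriv ?g) x\<bar> \<le> \<bar>C * l\<^sup>2 * (a * (a+1) / ((a+b) * (a+b+1)))\<bar>"
    "\<And>x. x > 0 \<Longrightarrow> \<bar>deriv (deriv ?g) x\<bar> \<le> D2 * x powr (-(a+2))"
    unfolding d(2) using kummer_scaled_bounds[OF a(2) ab(2) l, of "C * l\<^sup>2 * (a * (a+1) / ((a+b) * (a+b+1)))"] by blast
  have s: "smooth_pos ?g" by (rule kummer_smooth_pos[OF ab])
  note c = smooth_pos_continuous_ons[OF s]
  have w: "wl2 (?\<mu>+1) (deriv (deriv ?g))"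
    by (rule wl2_powr_bounds[OF c(3) _ _ D2]) (use ab ba in auto)
  have w1: "wl2 (?\<mu>+1) (deriv ?g)" "wl2 ?\<mu> (deriv ?g)"
    by (rule wl2_powr_bounds[OF c(2) _ _ D1]; use ab ba in auto)+
  have w0: "wl2 (?\<mu>-1) ?g"
    by (rule wl2_powr_bounds[OF c(1) _ _ D0]) (use ab ba in auto)
  have dec: "((\<lambda>x. x powr p * (\<phi> x)\<^sup>2) \<longlongrightarrow> 0) at_top"
    if p: "p - 2 * e < 0" and le: "\<And>x. x > 0 \<Longrightarrow> \<bar>\<phi> x\<bar> \<le> D * x powr (-e)" for p e D and \<phi> :: "real \<Rightarrow> real"
  proof (rule Lim_null_comparison)
    show "((\<lambda>x. D\<^sup>2 * x powr (p - 2 * e)) \<longlongrightarrow> 0) at_top"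
      by (intro tendsto_mult_right_zero tendsto_neg_powr[OF p] filterlim_ident)
    show "\<forall>\<^sub>F x in at_top. norm (x powr p * (\<phi> x)\<^sup>2) \<le> D\<^sup>2 * x powr (p - 2 * e)"
      using eventually_gt_at_top[of 0]
    proof eventually_elim
      case (elim x)
      have "\<bar>\<phi> x\<bar>\<^sup>2 \<le> (D * x powr (-e))\<^sup>2" by (rule power_mono[OF le[OF elim]]) simp
      hence "x powr p * (\<phi> x)\<^sup>2 \<le> x powr p * (D * x powr (-e))\<^sup>2" by (simp add: mult_left_mono)
      also have "\<dots> = D\<^sup>2 * (x powr p * x powr (-e) * x powr (-e))" by (simp add: power2_eq_square mult_ac)
      also have "x powr p * x powr (-e) * x powr (-e) = x powr (p - 2 * e)"
        by (simp add: powr_add[symmetric])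
      finally show ?case by simp
    qed
  qed
  have lim: "((\<lambda>x. x powr (?\<mu>+1) * (deriv ?g x)\<^sup>2 + x powr ?\<mu> * (?g x)\<^sup>2) \<longlongrightarrow> 0) at_top"
    by (rule tendsto_add_zero; rule dec[OF _ D1(2)] dec[OF _ D0(2)]; use ba in simp)
  have "Limsup (at_right 0) (\<lambda>x. ereal (\<bar>?g x\<bar> + \<bar>deriv ?g x\<bar>)) \<le>
      ereal (\<bar>C\<bar> + \<bar>- (C * l * (a / (a+b)))\<bar>)"
  proof (rule Limsup_bounded)
    show "\<forall>\<^sub>F x in at_right 0. ereal (\<bar>?g x\<bar> + \<bar>deriv ?g x\<bar>) \<le> ereal (\<bar>C\<bar> + \<bar>- (C * l * (a / (a+b)))\<bar>)"
      using eventually_at_right_less[of 0]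
      by eventually_elim (simp only: ereal_less_eq, intro add_mono D0 D1, auto)
  qed
  hence "Limsup (at_right 0) (\<lambda>x. ereal (\<bar>?g x\<bar> + \<bar>deriv ?g x\<bar>)) < \<infinity>" by auto
  hence "?g \<in> Cinf_mu ?\<mu>" using s lim by (simp add: Cinf_mu_def)
  thus ?thesis using w w1 w0 by (simp add: Dpre_iff)
qed

lemma kummer_op_kummer:
  assumes "0 < a" "0 < b"
  shows "kummer_op (a + b) a l (\<lambda>x. C * kummer a b (l * x)) x = 0"
proof -
  have "kummer_op (a + b) a l (\<lambda>x. C * kummer a b (l * x)) x =
    C * l * (l * x * (a * (a+1) / ((a+b) * (a+b+1)) * kummer (a+2) b (l * x))
    - (a + b + l * x) * (a / (a+b) * kummer (a+1) b (l * x)) + a * kummer a b (l * x))"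
    unfolding kummer_op_def kummer_derivs(2)[OF assms] unfolding kummer_derivs(1)[OF assms] by (simp add: algebra_simps power2_eq_square)
  thus ?thesis using kummer_ODE[OF assms, of "l * x"] by simp
qed

section \<open>The case of equality\<close>

text \<open>\<open>W\<close> is the Wronskian of \<open>g\<close> and the Kummer function times its integrating factor, so
  \<open>W' = x powr (\<mu>-1) * exp (l x) * u * kummer_op g\<close> and \<open>W\<close> vanishes at 0.\<close>
lemma kummer_wronskian_bound:
  assumes ab: "0 < a" "0 < b" and l: "l > 0" and g: "g \<in> Dpre (a + b)" and x: "x > 0"
  defines "u \<equiv> \<lambda>x. kummer a b (l * x)" and "u' \<equiv> \<lambda>x. - (a / (a+b)) * kummer (a+1) b (l * x) * l"
  defines "W \<equiv> \<lambda>x. x powr (a+b) * exp (l * x) * (deriv g x * u x - g x * u' x)"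
  shows "(W x)\<^sup>2 \<le> (exp (l * x))\<^sup>2 * x powr (a+b) / (a+b) * wint (a+b-1) (kummer_op (a+b) a l g)"
proof -
  define \<mu> where "\<mu> = a + b"
  have mu: "\<mu> > 0" using ab by (simp add: \<mu>_def)
  let ?f = "kummer_op \<mu> a l g"
  have s: "smooth_pos g" and ci: "g \<in> Cinf_mu \<mu>" using g by (auto simp: Dpre_def Cinf_mu_def \<mu>_def)
  note D = smooth_pos_DERIVs[OF s]
  define u'' where "u'' x = l\<^sup>2 * (a * (a+1) / ((a+b) * (a+b+1))) * kummer (a+2) b (l * x)" for x
  have du: "(u has_real_derivative u' x) (at x)" for x
    unfolding u_def u'_def by (rule kummer_scaled_DERIV[OF ab])
  have du': "(u' has_real_derivative u'' x) (at x)" for x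
  proof -
    have "((\<lambda>x. kummer (a+1) b (l * x)) has_real_derivative
        - ((a+1) / (a+1+b)) * kummer (a+1+1) b (l * x) * l) (at x)"
      by (rule kummer_scaled_DERIV) (use ab in auto)
    from DERIV_cmult[OF this, of "- (a / (a+b)) * l"] show ?thesis
      by (simp add: u'_def u''_def power2_eq_square add_ac mult_ac)
  qed
  have ode: "x * u'' x + (\<mu> + l * x) * u' x + a * l * u x = 0" for x
  proof -
    have "kummer_op (a + b) a l (\<lambda>x. 1 * kummer a b (l * x)) x = 0" by (rule kummer_op_kummer[OF ab])
    thus ?thesis unfolding kummer_op_def kummer_derivs(2)[OF ab] unfolding kummer_derivs(1)[OF ab]
      by (simp add: u_def u'_def u''_def \<mu>_def mult_ac)
  qed
  have dW: "(W has_real_derivative y powr (\<mu>-1) * exp (l * y) * (?f y * u y)) (at y)" if y: "y > 0" for y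
  proof -
    have e: "y powr \<mu> = y * y powr (\<mu>-1)" using y by (simp add: powr_diff)
    have "(W has_real_derivative (\<mu> * y powr (\<mu>-1) * exp (l * y) + y powr \<mu> * (exp (l * y) * l)) *
        (deriv g y * u y - g y * u' y) + y powr \<mu> * exp (l * y) *
        (deriv (deriv g) y * u y + deriv g y * u' y - (deriv g y * u' y + g y * u'' y))) (at y)"
      unfolding W_def \<mu>_def[symmetric]
      using y by (auto intro!: derivative_eq_intros D has_real_derivative_powr du du' simp: algebra_simps)
    \<comment> \<open>The products g' u' cancel, and what remains groups into u L g - g L u, of
      which the second part vanishes.\<close>
    also have "(\<mu> * y powr (\<mu>-1) * exp (l * y) + y powr \<mu> * (exp (l * y) * l)) *
        (deriv g y * u y - g y * u' y) + y powr \<mu> * exp (l * y) *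
        (deriv (deriv g) y * u y + deriv g y * u' y - (deriv g y * u' y + g y * u'' y)) =
        y powr (\<mu>-1) * exp (l * y) * (u y * ?f y - g y * (y * u'' y + (\<mu> + l * y) * u' y + a * l * u y))"
      unfolding e kummer_op_def by (simp add: algebra_simps)
    finally show ?thesis unfolding ode by (simp add: mult_ac)
  qed
  have W0: "(W \<longlongrightarrow> 0) (at_right 0)"
  proof -
    have c: "(u \<longlongrightarrow> u 0) (at_right 0)" "(u' \<longlongrightarrow> u' 0) (at_right 0)"
      using DERIV_isCont[OF du, of 0] DERIV_isCont[OF du', of 0]
      by (auto simp: isCont_def intro: tendsto_within_subset)
    have "((\<lambda>x. exp (l * x) * (u x * (x powr \<mu> * deriv g x) - u' x * (x powr \<mu> * g x))) \<longlongrightarrow>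
        exp (l * 0) * (u 0 * 0 - u' 0 * 0)) (at_right 0)"
      by (intro tendsto_intros c Cinf_mu_limits_0[OF ci mu])
    thus ?thesis by (simp add: W_def \<mu>_def algebra_simps)
  qed
  note k = wint_kummer_op(1)[OF mu g[folded \<mu>_def], of a l]
  let ?F = "wint (\<mu>-1) ?f" and ?e = "exp (l * x)"
  \<comment> \<open>Cauchy-Schwarz on (0, x) in parametric form: |f| \<le> t/2 f^2 + 1/(2 t), and
    the contribution of the second summand is integrated exactly, since y powr (\<mu>-1) has
    integral x powr \<mu> / \<mu>. The sign \<sigma> serves to bound the absolute value.\<close>
  have b: "\<sigma> * W x \<le> ?e / 2 * (x powr \<mu> / (\<mu> * t) + t * ?F)" if t: "t > 0" and \<sigma>: "\<bar>\<sigma>\<bar> = 1" for t \<sigma> :: real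
  proof -
    let ?h = "\<lambda>y. ?e * t / 2 * ((?f y)\<^sup>2 * y powr (\<mu>-1))"
    let ?G = "\<lambda>y. \<sigma> * W y - ?e / (2 * \<mu> * t) * y powr \<mu>"
    have hi: "pos_integrable ?h" "pos_int ?h = ?e * t / 2 * ?F"
      using k unfolding wl2_def wint_def by (auto simp only: set_integrable_mult_right set_integral_mult_right)
    have "?G x - ?G \<eta> \<le> pos_int ?h" if \<eta>: "0 < \<eta>" "\<eta> \<le> x" for \<eta>
    proof (rule FTC_le_pos_int[OF \<eta> _ _ hi(1)])
      fix y assume y: "\<eta> \<le> y" "y \<le> x"
      hence y0: "y > 0" using \<eta> by simp
      show "(?G has_real_derivative \<sigma> * (y powr (\<mu>-1) * exp (l * y) * (?f y * u y))
          - ?e / (2 * \<mu> * t) * (\<mu> * y powr (\<mu>-1))) (at y)"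
        by (intro DERIV_diff DERIV_cmult dW has_real_derivative_powr y0)
      have u: "0 < u y" "u y \<le> 1"
        unfolding u_def using kummer_bounds[OF ab, of "l * y"] y0 l by auto
      have el: "exp (l * y) \<le> ?e" using y l by simp
      have "2 * t * \<bar>?f y\<bar> \<le> (t * \<bar>?f y\<bar>)\<^sup>2 + 1"
        using sum_squares_bound[of "t * \<bar>?f y\<bar>" 1] by simp
      hence f: "\<bar>?f y\<bar> \<le> t / 2 * (?f y)\<^sup>2 + 1 / (2 * t)"
        using t by (simp add: field_simps power2_eq_square)
      have "\<sigma> * (y powr (\<mu>-1) * exp (l * y) * (?f y * u y)) \<le> \<bar>\<sigma> * (y powr (\<mu>-1) * exp (l * y) * (?f y * u y))\<bar>"
        by (rule abs_ge_self)
      also have "\<dots> = y powr (\<mu>-1) * (exp (l * y) * (\<bar>?f y\<bar> * u y))"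
        using \<sigma> u by (simp add: abs_mult)
      also have "\<dots> \<le> y powr (\<mu>-1) * (?e * ((t / 2 * (?f y)\<^sup>2 + 1 / (2 * t)) * 1))"
        using f u el t by (intro mult_left_mono mult_mono) auto
      also have "\<dots> = ?h y + ?e / (2 * \<mu> * t) * (\<mu> * y powr (\<mu>-1))"
        using mu t by (simp add: field_simps)
      finally show "\<sigma> * (y powr (\<mu>-1) * exp (l * y) * (?f y * u y))
          - ?e / (2 * \<mu> * t) * (\<mu> * y powr (\<mu>-1)) \<le> ?h y" by simp
    qed (use t in auto)
    hence ev: "\<forall>\<^sub>F \<eta> in at_right 0. ?G x - pos_int ?h \<le> ?G \<eta>"
      unfolding eventually_at_right_field using x by (intro exI[of _ x]) force
    have "(?G \<longlongrightarrow> \<sigma> * 0 - ?e / (2 * \<mu> * t) * 0) (at_right 0)"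
      by (intro tendsto_intros W0 powr_tendsto_0_at_right mu)
    from tendsto_lowerbound[OF this ev] have "?G x - pos_int ?h \<le> 0" by simp
    thus ?thesis unfolding hi(2) by (simp add: field_simps)
  qed
  have "0 \<le> ?e * x powr \<mu> / \<mu> - 2 * t * \<bar>W x\<bar> + t\<^sup>2 * (?e * ?F)" if t: "t > 0" for t
  proof -
    have "\<bar>W x\<bar> \<le> ?e / 2 * (x powr \<mu> / (\<mu> * t) + t * ?F)"
      using b[OF t, of 1] b[OF t, of "-1"] by (simp add: abs_le_iff)
    hence "2 * t * \<bar>W x\<bar> \<le> 2 * t * (?e / 2 * (x powr \<mu> / (\<mu> * t) + t * ?F))"
      using t by (intro mult_left_mono) auto
    also have "\<dots> = ?e * x powr \<mu> / \<mu> + t\<^sup>2 * (?e * ?F)"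
      using t mu by (simp add: field_simps power2_eq_square)
    finally show ?thesis by simp
  qed
  from quadratic_nonneg_imp(2)[OF this]
  have "\<bar>W x\<bar>\<^sup>2 \<le> ?e * x powr \<mu> / \<mu> * (?e * ?F)" using mu by simp
  thus ?thesis by (simp add: \<mu>_def power2_eq_square mult_ac)
qed

lemma Dmu_diff_const:
  assumes s: "s \<in> Dmu \<mu>" and v: "v \<in> Dpre \<mu>"
  shows "(\<lambda>n. s n - v) \<in> Dmu \<mu>"
proof -
  have "(s m - v) - (s n - v) = s m - s n" for m n by (rule ext) simp
  thus ?thesis using s Dpre_diff[OF _ v] by (auto simp: Dmu_def)
qed

text \<open>The quotient of \<open>s n\<close> by u has derivative W / (x powr \<mu> exp(l x) u^2),
  so Wronskians that tend to 0 locally uniformly make the quotients asymptotically constant. Solving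
  the definition of W for the derivative of \<open>s n\<close> then gives its pointwise convergence
  to C u'.\<close>

lemma Dmu_kummer_limit:
  assumes ab: "0 < a" "0 < b" "b < a" and l: "l > 0" and s: "s \<in> Dmu (a + b)"
    and F: "(\<lambda>n. wint (a+b-1) (kummer_op (a+b) a l (s n))) \<longlonglongrightarrow> 0"
  shows "\<exists>C. (\<lambda>n. Dnorm (a+b) (s n - (\<lambda>x. C * kummer a b (l * x)))) \<longlonglongrightarrow> 0"
proof -
  define \<mu> where "\<mu> = a + b"
  have mu: "\<mu> > 0" using ab by (simp add: \<mu>_def)
  note p = DmuD(1)[OF s]
  define u where "u x = kummer a b (l * x)" for x
  define u' where "u' x = - (a / (a+b)) * kummer (a+1) b (l * x) * l" for x
  define W where "W n x = x powr \<mu> * exp (l * x) * (deriv (s n) x * u x - s n x * u' x)" for n x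
  define F' where "F' n = wint (\<mu>-1) (kummer_op \<mu> a l (s n))" for n
  have F0: "F' \<longlonglongrightarrow> 0" using F by (simp add: F'_def[abs_def] \<mu>_def)
  have Wb: "(W n x)\<^sup>2 \<le> (exp (l * x))\<^sup>2 * x powr \<mu> / \<mu> * F' n" if "x > 0" for n x
    using kummer_wronskian_bound[OF ab(1,2) l p that, of n]
    by (simp add: W_def u_def u'_def F'_def \<mu>_def)
  have du: "(u has_real_derivative u' x) (at x)" for x
    unfolding u_def[abs_def] u'_def by (rule kummer_scaled_DERIV[OF ab(1,2)])
  have ub: "exp (- (l * x)) \<le> u x" "0 < u x" if "x > 0" for x
    using kummer_bounds[OF ab(1,2), of "l * x"] that l by (auto simp: u_def)
  have W0: "(\<lambda>n. W n x) \<longlonglongrightarrow> 0" if x: "x > 0" for x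
  proof -
    have "(\<lambda>n. (exp (l * x))\<^sup>2 * x powr \<mu> / \<mu> * F' n) \<longlonglongrightarrow> (exp (l * x))\<^sup>2 * x powr \<mu> / \<mu> * 0"
      by (intro tendsto_intros F0)
    hence "(\<lambda>n. (exp (l * x))\<^sup>2 * x powr \<mu> / \<mu> * F' n) \<longlonglongrightarrow> 0" by simp
    hence "(\<lambda>n. (W n x)\<^sup>2) \<longlonglongrightarrow> 0"
      by (rule Lim_null_comparison[rotated]) (use Wb[OF x] in \<open>simp add: always_eventually\<close>)
    thus ?thesis by simp
  qed
  define h where "h n x = s n x / u x" for n x
  have dh: "(h n has_real_derivative W n x / (x powr \<mu> * exp (l * x) * (u x)\<^sup>2)) (at x)"
    if x: "x > 0" for n x
    unfolding h_def W_def using x ub(2)[OF x]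
    by (auto intro!: derivative_eq_intros smooth_pos_DERIVs(1)[OF Dpre_smooth[OF p]] du
        simp: power2_eq_square)
  have hc: "(\<lambda>n. h n x - h n 1) \<longlonglongrightarrow> 0" if x: "x > 0" for x
  proof -
    define d where "d = min x 1"
    define R where "R = max x 1"
    have d: "0 < d" "d \<le> x" "x \<le> R" "d \<le> 1" "1 \<le> R" using x by (auto simp: d_def R_def)
    \<comment> \<open>M majorises (exp(2 l y))^2 y powr (-\<mu>) / \<mu> on [d, R]: the exponential
      is largest at R, the power at d.\<close>
    define M where "M = (exp (2 * l * R))\<^sup>2 * d powr (-\<mu>) / \<mu>"
    have M: "M \<ge> 0" using mu by (simp add: M_def)
    have hb: "\<bar>W n y / (y powr \<mu> * exp (l * y) * (u y)\<^sup>2)\<bar> \<le> sqrt (M * F' n)"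
      if y: "d \<le> y" "y \<le> R" for y n
    proof (rule real_le_rsqrt)
      have y0: "y > 0" using y d by simp
      have q: "exp (- (l * y)) \<le> exp (l * y) * (u y)\<^sup>2"
      proof -
        have "exp (- (l * y)) = exp (l * y) * (exp (- (l * y)))\<^sup>2"
          by (simp add: exp_minus power2_eq_square field_simps)
        also have "\<dots> \<le> exp (l * y) * (u y)\<^sup>2"
          using ub[OF y0] by (intro mult_left_mono power_mono) auto
        finally show ?thesis .
      qed
      have "(y powr \<mu> * exp (- (l * y)))\<^sup>2 \<le> (y powr \<mu> * exp (l * y) * (u y)\<^sup>2)\<^sup>2"
        using mult_left_mono[OF q, of "y powr \<mu>"] by (intro power_mono) (auto simp: mult.assoc)
      hence "\<bar>W n y / (y powr \<mu> * exp (l * y) * (u y)\<^sup>2)\<bar>\<^sup>2 \<le> (W n y)\<^sup>2 / (y powr \<mu> * exp (- (l * y)))\<^sup>2"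
        unfolding power2_abs power_divide
        using y0 ub(2)[OF y0] by (intro divide_left_mono mult_pos_pos zero_less_power) auto
      also have "\<dots> \<le> ((exp (l * y))\<^sup>2 * y powr \<mu> / \<mu> * F' n) / (y powr \<mu> * exp (- (l * y)))\<^sup>2"
        by (intro divide_right_mono Wb y0) simp
      also have "\<dots> = (exp (2 * l * y))\<^sup>2 * y powr (-\<mu>) / \<mu> * F' n"
      proof -
        have "exp (2 * l * y) = exp (l * y) * exp (l * y)" by (simp add: exp_add[symmetric])
        thus ?thesis using y0 mu by (simp add: powr_minus exp_minus power2_eq_square field_simps)
      qed
      also have "\<dots> \<le> M * F' n"
        unfolding M_def using y d l mu
        by (intro mult_right_mono divide_right_mono mult_mono power_mono)
          (auto simp: F'_def wint_nonneg intro!: powr_mono2')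
      finally show "\<bar>W n y / (y powr \<mu> * exp (l * y) * (u y)\<^sup>2)\<bar>\<^sup>2 \<le> M * F' n" .
    qed
    have nb: "norm (h n x - h n 1) \<le> sqrt (M * F' n) * norm (x - 1)" for n
    proof (rule field_differentiable_bound[of "{d..R}"])
      show "(h n has_real_derivative W n y / (y powr \<mu> * exp (l * y) * (u y)\<^sup>2)) (at y within {d..R})"
        if "y \<in> {d..R}" for y
        using dh[of y n] that d by (auto intro: has_field_derivative_at_within)
    qed (use hb d in auto)
    have lim: "(\<lambda>n. sqrt (M * F' n) * norm (x - 1)) \<longlonglongrightarrow> 0"
      using tendsto_mult_right[OF tendsto_real_sqrt[OF tendsto_mult_left[OF F0, of M]], of "norm (x - 1)"] by simp
    show ?thesis by (rule Lim_null_comparison[OF eventuallyI[OF nb] lim])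
  qed
  \<comment> \<open>The quotients are so far controlled only up to an additive constant depending on
    n; the pointwise bound by the norm makes their values at 1 converge, and this limit is
    C.\<close>
  have "Cauchy (\<lambda>n. s n 1)"
  proof (rule metric_CauchyI)
    fix e :: real assume e: "e > 0"
    then obtain N where N: "\<forall>m\<ge>N. \<forall>n\<ge>N. Dnorm (a+b) (s m - s n) < e / 2"
      using DmuD(2)[OF s, of "e/2"] by auto
    have "dist (s m 1) (s n 1) < e" if mn: "m \<ge> N" "n \<ge> N" for m n
    proof -
      have "1 powr \<mu> * ((s m - s n) 1)\<^sup>2 \<le> 2 * (Dnorm \<mu> (s m - s n))\<^sup>2"
        by (rule Dpre_pointwise_bounds(1)[OF mu Dpre_diff[OF p p, folded \<mu>_def]]) simp
      also have "\<dots> \<le> 2 * (e / 2)\<^sup>2"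
        using N mn Dnorm2_nonneg[OF Dpre_diff[OF p p], of m n]
        by (intro mult_left_mono power_mono) (auto simp: \<mu>_def Dnorm_def less_imp_le)
      also have "\<dots> < e\<^sup>2" using e by (simp add: power2_eq_square)
      finally have "\<bar>s m 1 - s n 1\<bar>\<^sup>2 < e\<^sup>2" by simp
      from power2_less_imp_less[OF this] e show ?thesis by (simp add: dist_real_def)
    qed
    thus "\<exists>M. \<forall>m\<ge>M. \<forall>n\<ge>M. dist (s m 1) (s n 1) < e" by blast
  qed
  then obtain c1 where "(\<lambda>n. s n 1) \<longlonglongrightarrow> c1" by (auto simp: Cauchy_convergent_iff convergent_def)
  hence h1: "(\<lambda>n. h n 1) \<longlonglongrightarrow> c1 / u 1"
    unfolding h_def by (intro tendsto_intros) (use ub(2)[of 1] in auto)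
  define C where "C = c1 / u 1"
  have hx: "(\<lambda>n. h n x) \<longlonglongrightarrow> C" if "x > 0" for x
    using tendsto_add[OF hc[OF that] h1] by (simp add: C_def)
  define v where "v = (\<lambda>x. C * kummer a b (l * x))"
  have v: "v \<in> Dpre (a+b)" unfolding v_def by (rule kummer_in_Dpre[OF ab l])
  have dv: "deriv v x = C * u' x" for x
    unfolding v_def kummer_derivs(1)[OF ab(1,2)] u'_def by simp
  have z: "(\<lambda>n. s n - v) \<in> Dmu \<mu>" unfolding \<mu>_def by (rule Dmu_diff_const[OF s v])
  have "(\<lambda>n. Dnorm \<mu> (s n - v)) \<longlonglongrightarrow> 0"
  proof (rule Dmu_tendsto_0[OF mu z])
    fix x :: real assume x: "x > 0"
    have e: "deriv (s n - v) x = W n x / (x powr \<mu> * exp (l * x)) / u x + h n x * u' x - C * u' x" for n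
    proof -
      have "W n x / (x powr \<mu> * exp (l * x)) / u x = deriv (s n) x - s n x * u' x / u x"
        using x ub(2)[OF x] by (simp add: W_def field_simps)
      thus ?thesis using x by (simp add: derivs_diff[OF Dpre_smooth[OF p] Dpre_smooth[OF v]] dv h_def)
    qed
    have "(\<lambda>n. W n x / (x powr \<mu> * exp (l * x)) / u x + h n x * u' x - C * u' x) \<longlonglongrightarrow>
        0 / (x powr \<mu> * exp (l * x)) / u x + C * u' x - C * u' x"
      by (intro tendsto_intros W0 hx x) (use x ub(2)[OF x] in auto)
    thus "(\<lambda>n. deriv (s n - v) x) \<longlonglongrightarrow> 0" unfolding e by simp
  qed
  thus ?thesis unfolding \<mu>_def v_def by blast
qed

lemma Dnorm_self:
  assumes "g \<in> Dpre \<mu>"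
  shows "Dnorm \<mu> (g - g) = 0"
proof -
  note s = Dpre_smooth[OF assms]
  have "wint p (deriv (deriv (g - g))) = wint p (\<lambda>_. 0)" "wint p (deriv (g - g)) = wint p (\<lambda>_. 0)"
    "wint p (g - g) = wint p (\<lambda>_. 0)" for p
    by (rule wint_cong; simp add: derivs_diff[OF s s])+
  thus ?thesis unfolding Dnorm_def Dnorm2_eq[OF Dpre_diff[OF assms assms]]
    by (simp add: wint_def)
qed

lemma Dmu_const: "g \<in> Dpre \<mu> \<Longrightarrow> (\<lambda>_. g) \<in> Dmu \<mu>"
  by (simp add: Dmu_def Dnorm_self)

text \<open>A vanishing integral would force the derivative at 1 to vanish, by the pointwise bound,
  but it is a nonzero multiple of \<open>kummer (a+1) b 1\<close>. Hence the extremal is admissible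
  in the infimum.\<close>

lemma kummer_wint_deriv_pos:
  assumes ab: "0 < a" "0 < b" "b < a"
  shows "0 < wint (a+b) (deriv (\<lambda>x. 1 * kummer a b (1 * x)))"
proof -
  let ?v = "\<lambda>x. 1 * kummer a b (1 * x)"
  have v: "?v \<in> Dpre (a+b)" by (rule kummer_in_Dpre[OF ab]) simp
  have mu: "a + b > 0" using ab by simp
  have "deriv ?v 1 \<noteq> 0"
    unfolding kummer_derivs(1)[OF ab(1,2)] using ab kummer_bounds(3)[of "a+1" b 1] by simp
  moreover have "deriv ?v 1 = 0" if "wint (a+b) (deriv ?v) = 0"
    using Dpre_pointwise_bounds(2)[OF mu v, of 1] that by simp
  ultimately show ?thesis using wint_nonneg[of "a+b" "deriv ?v"] by fastforce
qed

theorem theorem3: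
  fixes \<mu> \<epsilon> :: real
  assumes "\<mu> > 0" and "\<epsilon> > 0" and "\<epsilon> < \<mu>\<^sup>2 / 4"
  defines "K \<equiv> (sqrt (\<mu>\<^sup>2 - 4 * \<epsilon>) + 1)\<^sup>2 / 4"
      and "b \<equiv> (\<mu> - sqrt (\<mu>\<^sup>2 - 4 * \<epsilon>)) / 2"
  shows "(\<forall>s \<in> Dmu \<mu>. I_gpp \<mu> s * I_eps \<mu> \<epsilon> s \<ge> K * (I_gp \<mu> s)\<^sup>2)
    \<and> K = Inf {I_gpp \<mu> s * I_eps \<mu> \<epsilon> s / (I_gp \<mu> s)\<^sup>2 | s.
                   s \<in> Dmu \<mu> \<and> \<not> ((\<lambda>n. Dnorm \<mu> (s n)) \<longlonglongrightarrow> 0) \<and> I_gp \<mu> s \<noteq> 0}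
    \<and> (\<forall>C lam. lam > 0 \<longrightarrow> (\<lambda>x. C * exp (- lam * x) * hyp1F1 b \<mu> (lam * x)) \<in> Dpre \<mu>)
    \<and> (\<forall>s \<in> Dmu \<mu>. (I_gpp \<mu> s * I_eps \<mu> \<epsilon> s = K * (I_gp \<mu> s)\<^sup>2 \<longleftrightarrow>
           (\<exists>C lam. lam > 0 \<and>
              (\<lambda>n. Dnorm \<mu> (s n - (\<lambda>x. C * exp (- lam * x) * hyp1F1 b \<mu> (lam * x)))) \<longlonglongrightarrow> 0)))"
proof -
  note mu = \<open>\<mu> > 0\<close>
  define r where "r = sqrt (\<mu>\<^sup>2 - 4 * \<epsilon>)"
  define a where "a = (\<mu> + r) / 2"
  have r2: "r\<^sup>2 = \<mu>\<^sup>2 - 4 * \<epsilon>" and r0: "r > 0" using assms(3) by (simp_all add: r_def)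
  have "r\<^sup>2 < \<mu>\<^sup>2" using r2 assms(2) by simp
  hence "r < \<mu>" using mu by (simp add: power2_less_imp_less)
  hence ab: "0 < a" "0 < b" "b < a" using mu r0 by (auto simp: a_def b_def r_def[symmetric])
  have mu_eq: "\<mu> = a + b" unfolding a_def b_def r_def[symmetric] by (simp add: field_simps)
  have eps: "a * (a - \<mu>) = - \<epsilon>" using r2 by (simp add: a_def power2_eq_square field_simps)
  have a2: "2 * a - \<mu> + 1 = r + 1" by (simp add: a_def field_simps)
  have K: "K = ((r + 1) / 2)\<^sup>2" by (simp add: K_def r_def power_divide)
  have fn: "(\<lambda>x. C * exp (- lam * x) * hyp1F1 b \<mu> (lam * x)) = (\<lambda>x. C * kummer a b (lam * x))" for C lam
    by (simp add: kummer_def mu_eq mult.assoc)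
  have kD: "(\<lambda>x. C * kummer a b (lam * x)) \<in> Dpre \<mu>" if "lam > 0" for C lam
    using kummer_in_Dpre[OF ab that] by (simp add: mu_eq)
  have kop: "wint (\<mu>-1) (kummer_op \<mu> a lam g) = wint (\<mu>+1) (deriv (deriv g))
      + lam\<^sup>2 * (wint (\<mu>+1) (deriv g) - \<epsilon> * wint (\<mu>-1) g) - lam * (r + 1) * wint \<mu> (deriv g)"
    if "g \<in> Dpre \<mu>" for g lam
    unfolding wint_kummer_op(2)[OF mu that] eps a2 by simp

  have lims: "(\<lambda>n. wint (\<mu>+1) (deriv (deriv (s n)))) \<longlonglongrightarrow> I_gpp \<mu> s"
    "(\<lambda>n. wint (\<mu>+1) (deriv (s n)) - \<epsilon> * wint (\<mu>-1) (s n)) \<longlonglongrightarrow> I_eps \<mu> \<epsilon> s"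
    "(\<lambda>n. wint \<mu> (deriv (s n))) \<longlonglongrightarrow> I_gp \<mu> s" if s: "s \<in> Dmu \<mu>" for s
  proof -
    note c = Dmu_convergent[OF s]
    show "(\<lambda>n. wint (\<mu>+1) (deriv (deriv (s n)))) \<longlonglongrightarrow> I_gpp \<mu> s"
      "(\<lambda>n. wint \<mu> (deriv (s n))) \<longlonglongrightarrow> I_gp \<mu> s"
      using c(1,3) by (simp_all add: I_gpp_def I_gp_def wint_def convergent_LIMSEQ_iff)
    have "convergent (\<lambda>n. wint (\<mu>+1) (deriv (s n)) - \<epsilon> * wint (\<mu>-1) (s n))"
      by (intro convergent_diff convergent_mult convergent_const c)
    thus "(\<lambda>n. wint (\<mu>+1) (deriv (s n)) - \<epsilon> * wint (\<mu>-1) (s n)) \<longlonglongrightarrow> I_eps \<mu> \<epsilon> s"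
      by (simp add: I_eps_def eps_integral_eq[OF DmuD(1)[OF s]] convergent_LIMSEQ_iff)
  qed
  have nonneg: "0 \<le> I_gpp \<mu> s" "0 \<le> I_eps \<mu> \<epsilon> s" "0 \<le> I_gp \<mu> s"
    and ineq: "K * (I_gp \<mu> s)\<^sup>2 \<le> I_gpp \<mu> s * I_eps \<mu> \<epsilon> s" if s: "s \<in> Dmu \<mu>" for s
  proof -
    note l = lims[OF s]
    have 1: "0 \<le> wint (\<mu>+1) (deriv (s n)) - \<epsilon> * wint (\<mu>-1) (s n)"
      "((r + 1) / 2 * wint \<mu> (deriv (s n)))\<^sup>2 \<le>
        wint (\<mu>+1) (deriv (deriv (s n))) * (wint (\<mu>+1) (deriv (s n)) - \<epsilon> * wint (\<mu>-1) (s n))" for n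
      using Dpre_inequality[OF mu DmuD(1)[OF s], of a n] r0 unfolding eps a2 by auto
    show "0 \<le> I_gpp \<mu> s" "0 \<le> I_eps \<mu> \<epsilon> s" "0 \<le> I_gp \<mu> s"
      using LIMSEQ_le_const[OF l(1)] LIMSEQ_le_const[OF l(2)] LIMSEQ_le_const[OF l(3)] wint_nonneg 1(1)
      by blast+
    have "((r + 1) / 2 * I_gp \<mu> s)\<^sup>2 \<le> I_gpp \<mu> s * I_eps \<mu> \<epsilon> s"
    proof (rule LIMSEQ_le)
      show "(\<lambda>n. ((r + 1) / 2 * wint \<mu> (deriv (s n)))\<^sup>2) \<longlonglongrightarrow> ((r + 1) / 2 * I_gp \<mu> s)\<^sup>2"
        by (intro tendsto_intros l)
      show "(\<lambda>n. wint (\<mu>+1) (deriv (deriv (s n))) * (wint (\<mu>+1) (deriv (s n)) - \<epsilon> * wint (\<mu>-1) (s n)))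
          \<longlonglongrightarrow> I_gpp \<mu> s * I_eps \<mu> \<epsilon> s"
        by (intro tendsto_mult l)
    qed (use 1(2) in blast)
    thus "K * (I_gp \<mu> s)\<^sup>2 \<le> I_gpp \<mu> s * I_eps \<mu> \<epsilon> s" unfolding K power_mult_distrib .
  qed

  have eq_if: "I_gpp \<mu> s * I_eps \<mu> \<epsilon> s = K * (I_gp \<mu> s)\<^sup>2"
    if s: "s \<in> Dmu \<mu>" and lam: "lam > 0"
      and l0: "(\<lambda>n. Dnorm \<mu> (s n - (\<lambda>x. C * kummer a b (lam * x)))) \<longlonglongrightarrow> 0" for s C lam
  proof -
    let ?v = "\<lambda>x. C * kummer a b (lam * x)"
    note l = Dnorm_tendsto_0_imp_wint[OF DmuD(1)[OF s] kD[OF lam] l0]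
    note L = lims[OF s]
    have A: "I_gpp \<mu> s = wint (\<mu>+1) (deriv (deriv ?v))" by (rule LIMSEQ_unique[OF L(1) l(1)])
    have D: "I_gp \<mu> s = wint \<mu> (deriv ?v)" by (rule LIMSEQ_unique[OF L(3) l(3)])
    have B: "I_eps \<mu> \<epsilon> s = wint (\<mu>+1) (deriv ?v) - \<epsilon> * wint (\<mu>-1) ?v"
      by (rule LIMSEQ_unique[OF L(2)]) (intro tendsto_intros l)
    have "wint (\<mu>-1) (kummer_op \<mu> a lam ?v) = 0"
      using kummer_op_kummer[OF ab(1,2), of lam C] by (simp add: mu_eq wint_def)
    hence e: "I_gpp \<mu> s + lam\<^sup>2 * I_eps \<mu> \<epsilon> s = lam * (r + 1) * I_gp \<mu> s"
      unfolding kop[OF kD[OF lam]] A B D by simp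
    \<comment> \<open>The arithmetic-geometric inequality for the two summands on the left of
      \<open>e\<close> yields the reverse of the inequality already shown.\<close>
    have "lam\<^sup>2 * (4 * (I_gpp \<mu> s * I_eps \<mu> \<epsilon> s)) \<le> (I_gpp \<mu> s + lam\<^sup>2 * I_eps \<mu> \<epsilon> s)\<^sup>2"
      using zero_le_power2[of "I_gpp \<mu> s - lam\<^sup>2 * I_eps \<mu> \<epsilon> s"]
      by (simp add: power2_eq_square algebra_simps)
    also have "\<dots> = lam\<^sup>2 * (4 * (K * (I_gp \<mu> s)\<^sup>2))"
      unfolding e K by (simp add: power_mult_distrib power_divide)
    finally have "I_gpp \<mu> s * I_eps \<mu> \<epsilon> s \<le> K * (I_gp \<mu> s)\<^sup>2" using lam by simp
    thus ?thesis using ineq[OF s] by simp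
  qed

  have only_if: "\<exists>C lam. lam > 0 \<and> (\<lambda>n. Dnorm \<mu> (s n - (\<lambda>x. C * kummer a b (lam * x)))) \<longlonglongrightarrow> 0"
    if s: "s \<in> Dmu \<mu>" and eq: "I_gpp \<mu> s * I_eps \<mu> \<epsilon> s = K * (I_gp \<mu> s)\<^sup>2" for s
  proof (cases "I_gp \<mu> s = 0")
    case True
    note L = lims[OF s]
    \<comment> \<open>The second-derivative integrals converge while those of (g')^2 x powr \<mu>
      tend to 0, so the derivatives tend to 0 pointwise. The sequence represents the zero element,
      covered by C = 0 with an arbitrary positive \<open>lam\<close>.\<close>
    have "(\<lambda>n. Dnorm \<mu> (s n)) \<longlonglongrightarrow> 0"
    proof (rule Dmu_tendsto_0[OF mu s])
      fix x :: real assume x: "x > 0"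
      have "(\<lambda>n. 2 * (sqrt (wint \<mu> (deriv (s n))) * sqrt (wint (\<mu>+1) (deriv (deriv (s n))))) / x powr (\<mu> + 1/2))
          \<longlonglongrightarrow> 2 * (sqrt 0 * sqrt (I_gpp \<mu> s)) / x powr (\<mu> + 1/2)"
        by (intro tendsto_intros L(1) L(3)[unfolded True]) (use x in auto)
      hence lim: "(\<lambda>n. 2 * (sqrt (wint \<mu> (deriv (s n))) * sqrt (wint (\<mu>+1) (deriv (deriv (s n))))) / x powr (\<mu> + 1/2))
          \<longlonglongrightarrow> 0" by simp
      have "norm ((deriv (s n) x)\<^sup>2) \<le>
          2 * (sqrt (wint \<mu> (deriv (s n))) * sqrt (wint (\<mu>+1) (deriv (deriv (s n))))) / x powr (\<mu> + 1/2)" for n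
        using Dpre_pointwise_bounds(2)[OF mu DmuD(1)[OF s] x, of n] x by (simp add: field_simps)
      from Lim_null_comparison[OF eventuallyI[OF this] lim]
      show "(\<lambda>n. deriv (s n) x) \<longlonglongrightarrow> 0" by simp
    qed
    moreover have "s n - (\<lambda>x. 0 * kummer a b (1 * x)) = s n" for n by (rule ext) simp
    ultimately have "(1::real) > 0 \<and> (\<lambda>n. Dnorm \<mu> (s n - (\<lambda>x. 0 * kummer a b (1 * x)))) \<longlonglongrightarrow> 0" by simp
    thus ?thesis by blast
  next
    case False
    note L = lims[OF s]
    define A where "A = I_gpp \<mu> s"
    define B where "B = I_eps \<mu> \<epsilon> s"
    define D where "D = I_gp \<mu> s"
    have D: "D > 0" using False nonneg(3)[OF s] by (simp add: D_def)
    have "K > 0" using r0 by (simp add: K)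
    hence "A * B > 0" using eq D by (simp add: A_def B_def D_def)
    hence AB: "A > 0" "B > 0" using nonneg[OF s] by (auto simp: A_def B_def zero_less_mult_iff)
    \<comment> \<open>This value minimises A / lam + lam B; under equality the quadratic A + lam^2 B
      - lam (r + 1) D has its double root there.\<close>
    define lam where "lam = sqrt (A / B)"
    have lam: "lam > 0" and lam2: "lam\<^sup>2 = A / B" using AB by (simp_all add: lam_def)
    have KD: "K * D\<^sup>2 = A * B" using eq by (simp add: A_def B_def D_def)
    have "(lam * (r + 1) * D)\<^sup>2 = lam\<^sup>2 * (4 * (K * D\<^sup>2))"
      unfolding K by (simp add: power_mult_distrib power_divide)
    also have "\<dots> = (2 * A)\<^sup>2"
      unfolding lam2 KD using AB by (simp add: power2_eq_square)
    finally have "lam * (r + 1) * D = 2 * A"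
      by (rule power2_eq_imp_eq) (use lam r0 D AB in auto)
    hence z: "A + lam\<^sup>2 * B - lam * (r + 1) * D = 0" using AB lam2 by simp
    have "(\<lambda>n. wint (\<mu>-1) (kummer_op \<mu> a lam (s n))) \<longlonglongrightarrow> A + lam\<^sup>2 * B - lam * (r + 1) * D"
      unfolding kop[OF DmuD(1)[OF s]] A_def B_def D_def by (intro tendsto_intros L)
    hence "\<exists>C. (\<lambda>n. Dnorm \<mu> (s n - (\<lambda>x. C * kummer a b (lam * x)))) \<longlonglongrightarrow> 0"
      using Dmu_kummer_limit[OF ab lam, of s] s unfolding z mu_eq by blast
    thus ?thesis using lam by blast
  qed

  let ?X = "{I_gpp \<mu> s * I_eps \<mu> \<epsilon> s / (I_gp \<mu> s)\<^sup>2 | s.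
                   s \<in> Dmu \<mu> \<and> \<not> ((\<lambda>n. Dnorm \<mu> (s n)) \<longlonglongrightarrow> 0) \<and> I_gp \<mu> s \<noteq> 0}"
  \<comment> \<open>The infimum is a minimum, attained by the constant sequence of the extremal with
    C = 1 and \<open>lam = 1\<close>.\<close>
  have "Inf ?X = K"
  proof (rule cInf_eq_minimum)
    let ?v = "\<lambda>x. 1 * kummer a b (1 * x)"
    have v: "?v \<in> Dpre \<mu>" by (rule kD) simp
    have s: "(\<lambda>n. ?v) \<in> Dmu \<mu>" by (rule Dmu_const[OF v])
    have pos: "0 < wint \<mu> (deriv ?v)" using kummer_wint_deriv_pos[OF ab] by (simp only: mu_eq)
    have gp: "I_gp \<mu> (\<lambda>n. ?v) = wint \<mu> (deriv ?v)"
      by (rule LIMSEQ_unique[OF lims(3)[OF s] tendsto_const])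
    have "0 < sqrt (wint \<mu> (deriv ?v))" using pos by simp
    hence "0 < Dnorm \<mu> ?v" using wint_le_Dnorm(3)[OF v] by (rule less_le_trans)
    hence n: "\<not> ((\<lambda>n. Dnorm \<mu> ?v) \<longlonglongrightarrow> 0)" by (simp add: LIMSEQ_const_iff)
    have "I_gpp \<mu> (\<lambda>n. ?v) * I_eps \<mu> \<epsilon> (\<lambda>n. ?v) = K * (I_gp \<mu> (\<lambda>n. ?v))\<^sup>2"
      by (rule eq_if[OF s zero_less_one, where C = 1]) (simp only: Dnorm_self[OF v] tendsto_const)
    moreover have ne: "I_gp \<mu> (\<lambda>n. ?v) \<noteq> 0" unfolding gp by (rule less_imp_neq[OF pos, symmetric])
    ultimately have eq: "K = I_gpp \<mu> (\<lambda>n. ?v) * I_eps \<mu> \<epsilon> (\<lambda>n. ?v) / (I_gp \<mu> (\<lambda>n. ?v))\<^sup>2"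
      by (metis nonzero_mult_div_cancel_right power_not_zero)
    show "K \<in> ?X"
      by (rule CollectI, rule exI[of _ "\<lambda>n. ?v"], intro conjI eq s n ne)
  next
    fix y assume "y \<in> ?X"
    then obtain s where s: "s \<in> Dmu \<mu>" "I_gp \<mu> s \<noteq> 0"
      and y: "y = I_gpp \<mu> s * I_eps \<mu> \<epsilon> s / (I_gp \<mu> s)\<^sup>2" by blast
    show "K \<le> y" unfolding y using ineq[OF s(1)] s(2) by (simp add: le_divide_eq)
  qed
  hence best: "K = Inf ?X" by (rule sym)
  show ?thesis unfolding fn
  proof (intro conjI ballI allI impI iffI)
    fix s assume "s \<in> Dmu \<mu>" "\<exists>C lam. lam > 0 \<and> (\<lambda>n. Dnorm \<mu> (s n - (\<lambda>x. C * kummer a b (lam * x)))) \<longlonglongrightarrow> 0"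
    thus "I_gpp \<mu> s * I_eps \<mu> \<epsilon> s = K * (I_gp \<mu> s)\<^sup>2" using eq_if by blast
  qed (fact ineq best kD only_if)+
qed

end
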